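(* Let $b\in L_1^{\mathrm{loc}}(\mathbb{R}^n)$. The following assertions are equivalent: (i) There exists a positive constant $C$ such that for each $\lambda>0$ the inequality $$|\{x\in\mathbb{R}^n: C_b(f)(x)>\lambda\}|\le C\int_{\mathbb{R}^n}\frac{|f(x)|}{\lambda}\left(1+\log^+\left(\frac{|f(x)|}{\lambda}\right)\right)dx$$ holds for all $f\in L(1+\log^+L)$. (ii) $b\in\operatorname{BMO}(\mathbb{R}^n)$.
   Context: Cubes in $\mathbb{R}^n$ have sides parallel to the coordinate axes. The maximal commutator is $C_b(f)(x)=\sup_{Q\ni x}\frac1{|Q|}\int_Q|b(x)-b(y)||f(y)|\,dy\in[0,\infty]$, the supremum being over all cubes $Q$ containing $x$. $L(1+\log^+L)$ is the set of measurable $f$ on $\mathbb{R}^n$ with $\int_{\mathbb{R}^n}|f(x)|(1+\log^+|f(x)|)\,dx<\infty$, where $\log^+t=\max\{\log t,0\}$ (and $\log^+0=0$). $b\in\operatorname{BMO}(\mathbb{R}^n)$ means $\|b\|_*=\sup_Q\frac1{|Q|}\int_Q|b(y)-b_Q|\,dy<\infty$, where $b_Q=\frac1{|Q|}\int_Q b$ and the supremum is over all cubes. *)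

theory Defs
  imports "HOL-Analysis.Analysis"
begin

text \<open>
  Cubes are closed and nondegenerate with sides parallel to the axes. Taking open cubes instead
  would change none of the suprema below.
\<close>

definition cubes :: "(real ^ 'n) set set" where
  "cubes = {cbox a (\<chi> i. a $ i + s) | a s. s > 0}"

definition locally_integrable :: "(real ^ 'n \<Rightarrow> real) \<Rightarrow> bool" where
  "locally_integrable b \<longleftrightarrow> (\<forall>K. compact K \<longrightarrow> set_integrable lebesgue K b)"

definition cube_mean :: "(real ^ 'n \<Rightarrow> real) \<Rightarrow> (real ^ 'n) set \<Rightarrow> real" where
  "cube_mean b Q = (LINT y:Q|lebesgue. b y) / measure lebesgue Q"

definition bmo_norm :: "(real ^ 'n \<Rightarrow> real) \<Rightarrow> ennreal" where
  "bmo_norm b =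
    (SUP Q\<in>cubes. (\<integral>\<^sup>+y\<in>Q. ennreal \<bar>b y - cube_mean b Q\<bar> \<partial>lebesgue) / emeasure lebesgue Q)"

text \<open>
  Local integrability is part of membership, since otherwise the mean over a cube would be a
  default value of the Bochner integral.
\<close>

definition BMO :: "(real ^ 'n \<Rightarrow> real) set" where
  "BMO = {b. locally_integrable b \<and> bmo_norm b < \<infinity>}"

definition log_plus :: "real \<Rightarrow> real" where
  "log_plus t = (if t > 0 then max (ln t) 0 else 0)"

definition L_log_L :: "(real ^ 'n \<Rightarrow> real) set" where
  "L_log_L = {f \<in> borel_measurable lebesgue.
    (\<integral>\<^sup>+x. ennreal (\<bar>f x\<bar> * (1 + log_plus \<bar>f x\<bar>)) \<partial>lebesgue) < \<infinity>}"

text \<open>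
  For Lebesgue measurable \<open>b\<close> and \<open>f\<close> the maximal commutator is Lebesgue measurable: the supremum
  may be restricted to the countably many cubes with rational data, and each of these contributes
  a measurable function of \<open>x\<close>. So its superlevel sets have a genuine Lebesgue measure.
\<close>

definition maximal_commutator ::
    "(real ^ 'n \<Rightarrow> real) \<Rightarrow> (real ^ 'n \<Rightarrow> real) \<Rightarrow> real ^ 'n \<Rightarrow> ennreal" where
  "maximal_commutator b f x =
    (SUP Q\<in>{Q \<in> cubes. x \<in> Q}.
      (\<integral>\<^sup>+y\<in>Q. ennreal (\<bar>b x - b y\<bar> * \<bar>f y\<bar>) \<partial>lebesgue) / emeasure lebesgue Q)"

end

theory Submission
  imports Defs
begin

text \<open>
  Sufficiency of BMO: for a cube \<open>Q\<close> containing \<open>x\<close>, the mean of \<open>\<bar>b x - b y\<bar> \<bar>f y\<bar>\<close> is at most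
  \<open>\<bar>b x - b\<^sub>Q\<bar>\<close> times the mean of \<open>\<bar>f\<bar>\<close> plus the mean of \<open>\<bar>b - b\<^sub>Q\<bar> \<bar>f\<bar>\<close>. By John--Nirenberg and
  Young's inequality \<open>s t \<le> s log\<^sup>+ s + e\<^sup>t - 1\<close>, a cube on which the second term is large satisfies
  \<open>\<bar>Q\<bar> \<le> C \<integral>\<^sub>Q \<bar>f\<bar> (1 + log\<^sup>+ \<bar>f\<bar>)\<close>, and Vitali's covering lemma applies. The first term is even of
  weak type (1,1), since \<open>\<bar>b x - b\<^sub>Q\<bar>\<close> has exponentially small distribution within any larger cube.

  Necessity: test with the indicator of \<open>Q\<close> at a level \<open>\<lambda> > max C 1\<close>. The superlevel set has measure
  less than \<open>\<bar>Q\<bar>\<close>, so some \<open>x\<close> in \<open>Q\<close> has \<open>\<integral>\<^sub>Q \<bar>b x - b y\<bar> dy \<le> \<lambda> \<bar>Q\<bar>\<close>, and the mean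
  oscillation on \<open>Q\<close> is at most \<open>2\<lambda>\<close>.
\<close>

text \<open>As a simp rule it replaces \<open>lebesgue\<close> by \<open>lborel\<close> and the measured set by its \<open>main_part\<close>.\<close>

declare emeasure_completion [simp del]

subsection \<open>Cubes and the Vitali covering lemma\<close>

text \<open>A point lies in uncountably many cubes, each with its own mean of \<open>b\<close>, so
  an exponential bound for one cube at a time does not yet control a supremum. Each such step is
  therefore brought to one form: a family of cubes with
  \<open>\<bar>Q\<bar> \<le> \<integral>\<^sub>Q h\<close> for one fixed integrable
  \<open>h\<close>, which covering turns into countably many dilates whose measures sum to at most a
  constant times the integral of \<open>h\<close>. The stopping argument, the tail bound over
  subcubes and both weak type bounds differ in the choice of \<open>h\<close>. Dilates are again
  cubes, so BMO estimates can be restarted on them; they may overlap, since only the sum of their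
  measures is used. The delicate factor is \<open>\<bar>b x - b\<^sub>Q\<bar>\<close>: it is
  unbounded and taken at the point itself, so it must be controlled by one exceptional set for all
  subcubes of a given cube at once. Exceptional sets are always produced as measurable supersets,
  because the sets of points they contain are described by uncountable unions.\<close>

definition cube :: "real ^ 'n \<Rightarrow> real \<Rightarrow> (real ^ 'n) set" where
  "cube a s = cbox a (\<chi> i. a $ i + s)"

text \<open>The radius is chosen so that the dilate contains the five times enlarged ball around \<open>a\<close> of
  radius \<open>CARD('n) * s\<close>, which in turn contains the cube.\<close>

definition dilate :: "real ^ 'n \<Rightarrow> real \<Rightarrow> (real ^ 'n) set" where
  "dilate a s = cube (\<chi> i. a $ i - 5 * real CARD('n) * s) (10 * real CARD('n) * s)"

lemma cubes_eq: "cubes = {cube a s | a s. s > 0}"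
  by (simp add: cubes_def cube_def)

lemma mem_cube: "x \<in> cube a s \<longleftrightarrow> (\<forall>i. a $ i \<le> x $ i \<and> x $ i \<le> a $ i + s)"
  by (simp add: cube_def mem_box_cart)

lemma cube_subset_cubeI:
  assumes "\<And>i. a' $ i \<le> a $ i" "\<And>i. a $ i + s \<le> a' $ i + s'"
  shows "cube a s \<subseteq> cube a' s'"
  using assms by (fastforce simp: mem_cube intro: order_trans)

lemma corner_in_cube: "s \<ge> 0 \<Longrightarrow> a \<in> cube a s"
  by (simp add: mem_cube)

lemma sets_cube [measurable, simp]: "cube a s \<in> sets lebesgue"
  by (simp add: cube_def)

lemma emeasure_cube:
  fixes a :: "real ^ 'n"
  assumes "s \<ge> 0"
  shows "emeasure lebesgue (cube a s) = ennreal (s ^ CARD('n))"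
proof -
  have ne: "cube a s \<noteq> {}" using corner_in_cube[OF assms, of a] by blast
  have "measure lborel (cube a s) = s ^ CARD('n)"
    using ne unfolding cube_def by (subst content_cbox_cart) auto
  moreover have "emeasure lborel (cube a s) = ennreal (measure lborel (cube a s))"
    using emeasure_lborel_cbox_finite[of a "\<chi> i. a $ i + s"]
    by (intro emeasure_eq_ennreal_measure) (auto simp: cube_def)
  ultimately show ?thesis by (simp add: cube_def emeasure_completion)
qed

lemma measure_cube:
  fixes a :: "real ^ 'n"
  shows "s \<ge> 0 \<Longrightarrow> measure lebesgue (cube a s) = s ^ CARD('n)"
  by (simp add: measure_def emeasure_cube)

lemma emeasure_dilate:
  fixes a :: "real ^ 'n"
  assumes "s \<ge> 0"
  shows "emeasure lebesgue (dilate a s) = ennreal ((10 * real CARD('n)) ^ CARD('n)) * emeasure lebesgue (cube a s)"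
  using assms by (simp add: dilate_def emeasure_cube power_mult_distrib flip: ennreal_mult)

lemma sets_dilate [measurable, simp]: "dilate a s \<in> sets lebesgue"
  by (simp add: dilate_def)

lemma cube_subset_cball:
  fixes a :: "real ^ 'n"
  assumes "s \<ge> 0"
  shows "cube a s \<subseteq> cball a (real CARD('n) * s)"
proof
  fix x assume x: "x \<in> cube a s"
  have "norm (x - a) \<le> (\<Sum>i\<in>UNIV. \<bar>(x - a) $ i\<bar>)" by (rule norm_le_l1_cart)
  also have "\<dots> \<le> (\<Sum>i\<in>(UNIV::'n set). s)"
  proof (rule sum_mono)
    fix i
    show "\<bar>(x - a) $ i\<bar> \<le> s" using x[unfolded mem_cube, rule_format, of i] by simp
  qed
  finally show "x \<in> cball a (real CARD('n) * s)"
    by (simp add: dist_norm norm_minus_commute)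
qed

lemma ball_subset_dilate:
  fixes a :: "real ^ 'n"
  shows "ball a (5 * (real CARD('n) * s)) \<subseteq> dilate a s"
proof
  fix x assume "x \<in> ball a (5 * (real CARD('n) * s))"
  then have n: "norm (x - a) < 5 * (real CARD('n) * s)"
    by (simp add: dist_norm norm_minus_commute)
  have "\<bar>x $ i - a $ i\<bar> \<le> norm (x - a)" for i
    using component_le_norm_cart[of "x - a" i] by simp
  then have "\<bar>x $ i - a $ i\<bar> \<le> 5 * (real CARD('n) * s)" for i
    using n by (meson less_le_not_le order_trans)
  then show "x \<in> dilate a s"
    unfolding dilate_def mem_cube by (auto simp: abs_le_iff algebra_simps add_increasing2)
qed

text \<open>The covering lemma for balls is applied to the balls of radius
  \<open>CARD('n) * s\<close> around the lower corners: each contains its cube, so disjoint balls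
  give disjoint cubes, and the five times enlarged ball stays inside the dilate.\<close>

lemma vitali_cubes:
  fixes F :: "((real ^ 'n) \<times> real) set"
  assumes F: "\<And>a s. (a, s) \<in> F \<Longrightarrow> 0 < s \<and> s \<le> B"
  obtains C where "countable C" "C \<subseteq> F" "disjoint_family_on (\<lambda>(a, s). cube a s) C"
    "\<And>a s. (a, s) \<in> F \<Longrightarrow> \<exists>(a', s') \<in> C. cube a s \<subseteq> dilate a' s'"
proof -
  let ?n = "real CARD('n)"
  obtain C where C: "countable C" "C \<subseteq> F"
    "pairwise (\<lambda>i j. disjnt (cball (fst i) (?n * snd i)) (cball (fst j) (?n * snd j))) C"
    "\<And>i. i \<in> F \<Longrightarrow> \<exists>j. j \<in> C \<and> \<not> disjnt (cball (fst i) (?n * snd i)) (cball (fst j) (?n * snd j)) \<and>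
                        cball (fst i) (?n * snd i) \<subseteq> ball (fst j) (5 * (?n * snd j))"
    by (rule Vitali_covering_lemma_cballs_balls[of F "\<lambda>i. ?n * snd i" "?n * B" fst])
       (use F in force, blast)
  show thesis
  proof (rule that[OF C(1,2)])
    show "disjoint_family_on (\<lambda>(a, s). cube a s) C"
      unfolding disjoint_family_on_def
    proof (intro ballI impI)
      fix i j assume ij: "i \<in> C" "j \<in> C" "i \<noteq> j"
      have s: "0 \<le> snd i" "0 \<le> snd j" using F[of "fst i" "snd i"] F[of "fst j" "snd j"] ij C(2) by auto
      have "disjnt (cball (fst i) (?n * snd i)) (cball (fst j) (?n * snd j))"
        using C(3) ij by (simp add: pairwise_def)
      then show "(case i of (a, s) \<Rightarrow> cube a s) \<inter> (case j of (a, s) \<Rightarrow> cube a s) = {}"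
        using cube_subset_cball[OF s(1), of "fst i"] cube_subset_cball[OF s(2), of "fst j"]
        by (fastforce simp: disjnt_def split: prod.splits)
    qed
  next
    fix a s assume as: "(a, s) \<in> F"
    from C(4)[OF this] obtain j where j: "j \<in> C" "cball a (?n * s) \<subseteq> ball (fst j) (5 * (?n * snd j))"
      by auto
    have "cube a s \<subseteq> dilate (fst j) (snd j)"
      using j(2) ball_subset_dilate[of "fst j" "snd j"] cube_subset_cball[of s a] F[OF as] by (meson less_imp_le order_trans)
    with j(1) show "\<exists>(a', s') \<in> C. cube a s \<subseteq> dilate a' s'" by (auto intro!: bexI[of _ j] split: prod.split)
  qed
qed

text \<open>Covering yields a countable set of pairs rather than a sequence, so sums are written as
  integrals over \<open>count_space\<close>. The bound is the pointwise one for indicators,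
  integrated with the order of integration exchanged.\<close>

lemma emeasure_UN_le_nn_integral:
  assumes "countable I" "\<And>i. i \<in> I \<Longrightarrow> A i \<in> sets M"
  shows "emeasure M (\<Union>i\<in>I. A i) \<le> (\<integral>\<^sup>+i. emeasure M (A i) \<partial>count_space I)"
proof -
  have m: "(\<Union>i\<in>I. A i) \<in> sets M" using assms by blast
  have "emeasure M (\<Union>i\<in>I. A i) = (\<integral>\<^sup>+x. indicator (\<Union>i\<in>I. A i) x \<partial>M)" using m by simp
  also have "\<dots> \<le> (\<integral>\<^sup>+x. (\<integral>\<^sup>+i. indicator (A i) x \<partial>count_space I) \<partial>M)"
  proof (rule nn_integral_mono)
    fix x
    show "indicator (\<Union>i\<in>I. A i) x \<le> (\<integral>\<^sup>+i. indicator (A i) x \<partial>count_space I :: ennreal)"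
    proof (cases "x \<in> (\<Union>i\<in>I. A i)")
      case True
      then obtain i where i: "i \<in> I" "x \<in> A i" by blast
      have "(1::ennreal) = indicator (A i) x" using i by simp
      also have "\<dots> \<le> (\<integral>\<^sup>+i. indicator (A i) x \<partial>count_space I)"
        by (rule nn_integral_ge_point[OF i(1)])
      finally show ?thesis using True by simp
    qed simp
  qed
  also have "\<dots> = (\<integral>\<^sup>+i. (\<integral>\<^sup>+x. indicator (A i) x \<partial>M) \<partial>count_space I)"
    using assms by (intro nn_integral_count_space_nn_integral) auto
  also have "\<dots> = (\<integral>\<^sup>+i. emeasure M (A i) \<partial>count_space I)"
    using assms by (intro nn_integral_cong) auto
  finally show ?thesis .
qed

text \<open>The left side is the measure of a disjoint union under
  \<open>density M h\<close>.\<close>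

lemma nn_integral_disjoint_UN_le:
  assumes I: "countable I" "\<And>i. i \<in> I \<Longrightarrow> A i \<in> sets M" "disjoint_family_on A I"
    and h: "h \<in> borel_measurable M"
  shows "(\<integral>\<^sup>+i. (\<integral>\<^sup>+x\<in>A i. h x \<partial>M) \<partial>count_space I) \<le> (\<integral>\<^sup>+x. h x \<partial>M)"
proof -
  have "(\<integral>\<^sup>+i. (\<integral>\<^sup>+x\<in>A i. h x \<partial>M) \<partial>count_space I) = (\<integral>\<^sup>+i. emeasure (density M h) (A i) \<partial>count_space I)"
    using I h by (intro nn_integral_cong) (simp add: emeasure_density)
  also have "\<dots> = emeasure (density M h) (\<Union>i\<in>I. A i)"
    using I by (intro emeasure_UN_countable[symmetric]) auto
  also have "\<dots> \<le> emeasure (density M h) (space M)"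
    using I by (intro emeasure_mono) (auto dest: sets.sets_into_space)
  also have "\<dots> = (\<integral>\<^sup>+x. h x \<partial>M)"
    using h by (subst emeasure_density) (auto intro!: nn_integral_cong)
  finally show ?thesis .
qed

text \<open>The measure of a selected dilate is a fixed multiple of that of its cube, which
  \<open>h\<close> dominates, and the selected cubes are disjoint, so the integrals of
  \<open>h\<close> over them add up to at most the whole. With a multiple of
  \<open>\<bar>f\<bar>\<close> for \<open>h\<close> this is the argument behind the weak (1,1) bound
  of the maximal function.\<close>

lemma weak_type_cubes:
  fixes F :: "((real ^ 'n) \<times> real) set"
  assumes h: "h \<in> borel_measurable lebesgue" "(\<integral>\<^sup>+x. h x \<partial>lebesgue) < \<infinity>"
    and F: "\<And>a s. (a, s) \<in> F \<Longrightarrow> 0 < s \<and> emeasure lebesgue (cube a s) \<le> (\<integral>\<^sup>+x\<in>cube a s. h x \<partial>lebesgue)"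
  obtains C where "countable C" "C \<subseteq> F"
    "\<And>a s. (a, s) \<in> F \<Longrightarrow> \<exists>(a', s') \<in> C. cube a s \<subseteq> dilate a' s'"
    "(\<integral>\<^sup>+(a, s). emeasure lebesgue (dilate a s) \<partial>count_space C)
       \<le> ennreal ((10 * real CARD('n)) ^ CARD('n)) * (\<integral>\<^sup>+x. h x \<partial>lebesgue)"
proof -
  define H where "H = enn2real (\<integral>\<^sup>+x. h x \<partial>lebesgue)"
  have H: "(\<integral>\<^sup>+x. h x \<partial>lebesgue) = ennreal H" "H \<ge> 0"
    using h(2) by (simp_all add: H_def)
  \<comment> \<open>Covering needs bounded side lengths. Domination by \<open>h\<close> gives
    \<open>s ^ CARD('n) \<le> H\<close>, hence \<open>s \<le> H\<close> as soon as
    \<open>s > 1\<close>.\<close>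
  have bound: "0 < s \<and> s \<le> 1 + H" if as: "(a, s) \<in> F" for a s
  proof (intro conjI)
    show s0: "0 < s" using F[OF as] by simp
    have "ennreal (s ^ CARD('n)) = emeasure lebesgue (cube a s)" using s0 by (simp add: emeasure_cube)
    also have "\<dots> \<le> (\<integral>\<^sup>+x\<in>cube a s. h x \<partial>lebesgue)" using F[OF as] by simp
    also have "\<dots> \<le> (\<integral>\<^sup>+x. h x \<partial>lebesgue)"
      by (intro nn_integral_mono) (auto split: split_indicator)
    finally have le: "s ^ CARD('n) \<le> H" using H by (simp add: s0 less_imp_le)
    show "s \<le> 1 + H"
    proof (cases "s \<le> 1")
      case False
      then have "s ^ 1 \<le> s ^ CARD('n)" by (intro power_increasing) auto
      with le show ?thesis by simp
    qed (use H in simp)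
  qed
  obtain C where C: "countable C" "C \<subseteq> F" "disjoint_family_on (\<lambda>(a, s). cube a s) C"
    "\<And>a s. (a, s) \<in> F \<Longrightarrow> \<exists>(a', s') \<in> C. cube a s \<subseteq> dilate a' s'"
    by (rule vitali_cubes[of F "1 + H"]) (use bound in blast, blast)
  let ?D = "ennreal ((10 * real CARD('n)) ^ CARD('n))"
  have "(\<integral>\<^sup>+(a, s). emeasure lebesgue (dilate a s) \<partial>count_space C)
      = (\<integral>\<^sup>+i. ?D * emeasure lebesgue (case i of (a, s) \<Rightarrow> cube a s) \<partial>count_space C)"
  proof (rule nn_integral_cong)
    fix i assume "i \<in> space (count_space C)"
    then show "(case i of (a, s) \<Rightarrow> emeasure lebesgue (dilate a s)) = ?D * emeasure lebesgue (case i of (a, s) \<Rightarrow> cube a s)"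
      using C(2) F[of "fst i" "snd i"] emeasure_dilate[of "snd i" "fst i"]
      by (auto split: prod.splits)
  qed
  also have "\<dots> \<le> (\<integral>\<^sup>+i. ?D * (\<integral>\<^sup>+x\<in>(case i of (a, s) \<Rightarrow> cube a s). h x \<partial>lebesgue) \<partial>count_space C)"
    using C(2) F by (intro nn_integral_mono mult_left_mono) (auto split: prod.split)
  also have "\<dots> = ?D * (\<integral>\<^sup>+i. (\<integral>\<^sup>+x\<in>(case i of (a, s) \<Rightarrow> cube a s). h x \<partial>lebesgue) \<partial>count_space C)"
    by (intro nn_integral_cmult) simp
  also have "\<dots> \<le> ?D * (\<integral>\<^sup>+x. h x \<partial>lebesgue)"
    using C by (intro mult_left_mono nn_integral_disjoint_UN_le h) (auto split: prod.split)
  finally have sum: "(\<integral>\<^sup>+(a, s). emeasure lebesgue (dilate a s) \<partial>count_space C)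
       \<le> ?D * (\<integral>\<^sup>+x. h x \<partial>lebesgue)" .
  show thesis by (rule that[OF C(1,2) _ sum]) (rule C(4))
qed

subsection \<open>Means over cubes\<close>

lemma locally_integrable_cube: "locally_integrable b \<Longrightarrow> set_integrable lebesgue (cube a s) b"
  by (simp add: locally_integrable_def cube_def compact_cbox)

lemma locally_integrable_measurable:
  fixes b :: "real ^ 'n \<Rightarrow> real"
  assumes "locally_integrable b"
  shows "b \<in> borel_measurable lebesgue"
proof (rule borel_measurable_LIMSEQ_real)
  show "(\<lambda>k. indicator (cball 0 (real k)) x *\<^sub>R b x) \<longlonglongrightarrow> b x" for x
  proof (rule tendsto_eventually)
    have "eventually (\<lambda>k. k \<ge> nat \<lceil>norm x\<rceil>) sequentially" by (rule eventually_ge_at_top)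
    then show "eventually (\<lambda>k. indicator (cball 0 (real k)) x *\<^sub>R b x = b x) sequentially"
    proof eventually_elim
      case (elim k)
      then have "norm x \<le> real k" by linarith
      then show ?case by simp
    qed
  qed
  show "(\<lambda>x. indicator (cball 0 (real k)) x *\<^sub>R b x) \<in> borel_measurable lebesgue" for k
    using assms compact_cball[of "0::real^'n" "real k"]
    unfolding locally_integrable_def set_integrable_def by (blast dest: borel_measurable_integrable)
qed

lemma locally_integrable_abs_diff:
  fixes b :: "real ^ 'n \<Rightarrow> real"
  assumes "locally_integrable b"
  shows "locally_integrable (\<lambda>x. \<bar>b x - m\<bar>)"
  unfolding locally_integrable_def
proof (intro allI impI)
  fix K :: "(real ^ 'n) set" assume K: "compact K"
  have "set_integrable lebesgue K (\<lambda>x. m)"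
    using lmeasurable_compact[OF K] by (simp add: fmeasurable_def set_integrable_def)
  then have "set_integrable lebesgue K (\<lambda>x. b x - m)"
    using assms K by (intro set_integral_diff) (auto simp: locally_integrable_def)
  then show "set_integrable lebesgue K (\<lambda>x. \<bar>b x - m\<bar>)" by (rule set_integrable_abs)
qed

lemma nn_integral_cube_eq:
  assumes "locally_integrable g" "\<And>x. g x \<ge> 0"
  shows "(\<integral>\<^sup>+x\<in>cube a s. ennreal (g x) \<partial>lebesgue) = ennreal (LINT x:cube a s|lebesgue. g x)"
proof -
  have "(\<integral>\<^sup>+x\<in>cube a s. ennreal (g x) \<partial>lebesgue) = (\<integral>\<^sup>+x. ennreal (indicator (cube a s) x *\<^sub>R g x) \<partial>lebesgue)"
    by (intro nn_integral_cong) (auto split: split_indicator)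
  also have "\<dots> = ennreal (LINT x:cube a s|lebesgue. g x)"
    unfolding set_lebesgue_integral_def
    using locally_integrable_cube[OF assms(1), of a s] assms(2)
    by (intro nn_integral_eq_integral) (auto simp: set_integrable_def)
  finally show ?thesis .
qed

text \<open>\<open>m\<close> is left free: it stands for the mean over another cube in the BMO
  estimates and for a value \<open>b x\<close> in the necessity part.\<close>

lemma mean_diff_le:
  fixes b :: "real ^ 'n \<Rightarrow> real"
  assumes b: "locally_integrable b" and s: "s > 0"
  shows "ennreal (\<bar>cube_mean b (cube a s) - m\<bar> * s ^ CARD('n)) \<le> (\<integral>\<^sup>+x\<in>cube a s. ennreal \<bar>b x - m\<bar> \<partial>lebesgue)"
proof -
  let ?Q = "cube a s"
  have fin: "emeasure lebesgue ?Q < \<infinity>" using s by (simp add: emeasure_cube)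
  have int: "set_integrable lebesgue ?Q b" using b by (rule locally_integrable_cube)
  have intm: "set_integrable lebesgue ?Q (\<lambda>x. m)"
    using fin by (simp add: set_integrable_def)
  have c: "(LINT x:?Q|lebesgue. m) = m * s ^ CARD('n)"
    using s fin by (simp add: set_lebesgue_integral_def measure_cube)
  have "(cube_mean b ?Q - m) * s ^ CARD('n) = (LINT x:?Q|lebesgue. b x) - m * s ^ CARD('n)"
    using s by (simp add: cube_mean_def measure_cube field_simps)
  also have "\<dots> = (LINT x:?Q|lebesgue. b x - m)"
    using set_integral_diff(2)[OF int intm] c by simp
  finally have "\<bar>cube_mean b ?Q - m\<bar> * s ^ CARD('n) = \<bar>LINT x:?Q|lebesgue. b x - m\<bar>"
    using s by (metis abs_mult abs_of_pos zero_less_power)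
  also have "\<dots> \<le> (LINT x:?Q|lebesgue. \<bar>b x - m\<bar>)"
    using set_integral_norm_bound[OF set_integral_diff(1)[OF int intm]] by simp
  finally show ?thesis
    by (subst nn_integral_cube_eq[OF locally_integrable_abs_diff[OF b]]) (auto intro: ennreal_leI)
qed

text \<open>Only the lower half of the differentiation theorem is kept, since a stopping rule asks
  for means that exceed a level below \<open>g x\<close>. Most of the proof translates gauge
  integrals over boxes into \<open>cube_mean\<close>.\<close>

lemma lebesgue_differentiation_cube:
  fixes g :: "real ^ 'n \<Rightarrow> real"
  assumes g: "locally_integrable g"
  shows "AE x in lebesgue. \<forall>K < g x. \<exists>d>0. \<forall>h. 0 < h \<and> h < d \<longrightarrow> K < cube_mean g (cube x h)"
proof -
  have int: "g integrable_on cbox a b" for a b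
    using g set_lebesgue_integral_eq_integral(1)[of "cbox a b" g] by (simp add: locally_integrable_def compact_cbox)
  obtain N where N: "negligible N"
    and D: "\<And>x e. \<lbrakk>x \<notin> N; 0 < e\<rbrakk> \<Longrightarrow> \<exists>d>0. \<forall>h. 0 < h \<and> h < d \<longrightarrow>
       norm (integral (cbox x (x + h *\<^sub>R One)) g /\<^sub>R h ^ DIM(real ^ 'n) - g x) < e"
    using integrable_ccontinuous_explicit[of g] int by blast
  have box: "cbox x (x + h *\<^sub>R One) = cube x h" for x :: "real ^ 'n" and h
  proof -
    have "One $ i = (1::real)" for i :: 'n
      by (simp add: cart_eq_inner_axis inner_sum_left inner_Basis axis_in_Basis_iff)
    then show ?thesis by (auto simp: set_eq_iff mem_cube mem_box_cart)
  qed
  have mean: "integral (cbox x (x + h *\<^sub>R One)) g /\<^sub>R h ^ DIM(real ^ 'n) = cube_mean g (cube x h)" if "h > 0" for x h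
    using that set_lebesgue_integral_eq_integral(2)[OF locally_integrable_cube[OF g, of x h]]
    unfolding box by (simp add: cube_mean_def measure_cube divide_inverse mult.commute)
  have "AE x in lebesgue. x \<notin> N" using N by (simp add: negligible_iff_null_sets AE_not_in)
  then show ?thesis
  proof eventually_elim
    case (elim x)
    show ?case
    proof (intro allI impI)
      fix K assume K: "K < g x"
      then obtain d where d: "d > 0" "\<And>h. 0 < h \<and> h < d \<Longrightarrow>
         norm (integral (cbox x (x + h *\<^sub>R One)) g /\<^sub>R h ^ DIM(real ^ 'n) - g x) < g x - K"
        using D[OF elim, of "g x - K"] by auto
      have "K < cube_mean g (cube x h)" if "0 < h \<and> h < d" for h
        using d(2)[OF that] mean[of h x] that by (auto simp: abs_less_iff)
      then show "\<exists>d>0. \<forall>h. 0 < h \<and> h < d \<longrightarrow> K < cube_mean g (cube x h)" using d(1) by blast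
    qed
  qed
qed

text \<open>The BMO condition is multiplied out by the volume of the cube, so that later estimates
  do not divide in \<open>ennreal\<close>. \<open>B\<close> is any positive upper bound, not the
  norm itself.\<close>

locale bmo =
  fixes b :: "real ^ 'n \<Rightarrow> real" and B :: real
  assumes loc: "locally_integrable b" and B_pos: "B > 0"
    and osc: "\<And>a s. s > 0 \<Longrightarrow>
      (\<integral>\<^sup>+y\<in>cube a s. ennreal \<bar>b y - cube_mean b (cube a s)\<bar> \<partial>lebesgue) \<le> ennreal (B * s ^ CARD('n))"

lemma BMO_imp_bmo:
  fixes b :: "real ^ 'n \<Rightarrow> real"
  assumes "b \<in> BMO"
  obtains B where "bmo b B"
proof (rule that)
  \<comment> \<open>The added 1 keeps \<open>B\<close> positive when \<open>b\<close> is almost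
    everywhere constant.\<close>
  define B where "B = enn2real (bmo_norm b) + 1"
  have fin: "bmo_norm b < \<infinity>" and loc: "locally_integrable b" using assms by (auto simp: BMO_def)
  have B: "bmo_norm b \<le> ennreal B" using fin by (simp add: B_def ennreal_plus flip: ennreal_1)
  have B0: "B > 0" by (simp add: B_def add_nonneg_pos)
  show "bmo b B"
  proof
    fix a :: "real ^ 'n" and s :: real assume s: "s > 0"
    let ?I = "\<integral>\<^sup>+y\<in>cube a s. ennreal \<bar>b y - cube_mean b (cube a s)\<bar> \<partial>lebesgue"
    have "cube a s \<in> cubes" using s by (auto simp: cubes_eq)
    then have "?I / emeasure lebesgue (cube a s) \<le> bmo_norm b"
      unfolding bmo_norm_def by (rule SUP_upper)
    also note B
    finally have "?I / ennreal (s ^ CARD('n)) \<le> ennreal B" using s by (simp add: emeasure_cube)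
    then have "?I / ennreal (s ^ CARD('n)) * ennreal (s ^ CARD('n)) \<le> ennreal B * ennreal (s ^ CARD('n))"
      by (intro mult_right_mono) auto
    then show "?I \<le> ennreal (B * s ^ CARD('n))"
      using s B0 by (simp add: ennreal_mult ennreal_divide_times ennreal_times_divide mult_divide_eq_ennreal)
  qed (use loc B0 in auto)
qed

context bmo
begin

lemma b_measurable [measurable]: "b \<in> borel_measurable lebesgue"
  using loc by (rule locally_integrable_measurable)

text \<open>Restricting the oscillation integral of the large cube to the small one costs only the
  ratio of the volumes.\<close>

lemma mean_diff_subcube:
  fixes a a' :: "real ^ 'n"
  assumes sub: "cube a s \<subseteq> cube a' s'" and s: "s > 0" "s' > 0"
  shows "\<bar>cube_mean b (cube a s) - cube_mean b (cube a' s')\<bar> \<le> B * (s' / s) ^ CARD('n)"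
proof -
  let ?m = "cube_mean b (cube a' s')"
  have "ennreal (\<bar>cube_mean b (cube a s) - ?m\<bar> * s ^ CARD('n)) \<le> (\<integral>\<^sup>+x\<in>cube a s. ennreal \<bar>b x - ?m\<bar> \<partial>lebesgue)"
    by (rule mean_diff_le[OF loc s(1)])
  also have "\<dots> \<le> (\<integral>\<^sup>+x\<in>cube a' s'. ennreal \<bar>b x - ?m\<bar> \<partial>lebesgue)"
    using sub by (intro nn_integral_mono) (auto split: split_indicator)
  also have "\<dots> \<le> ennreal (B * s' ^ CARD('n))" using osc s by blast
  finally have "\<bar>cube_mean b (cube a s) - ?m\<bar> * s ^ CARD('n) \<le> B * s' ^ CARD('n)"
    using B_pos s by simp
  then show ?thesis using s by (simp add: power_divide field_simps)
qed

subsection \<open>The John--Nirenberg inequality\<close>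

lemma osc_about_le:
  fixes a :: "real ^ 'n"
  assumes s: "s > 0"
  shows "(\<integral>\<^sup>+y\<in>cube a s. ennreal \<bar>b y - m\<bar> \<partial>lebesgue) \<le> ennreal ((B + \<bar>cube_mean b (cube a s) - m\<bar>) * s ^ CARD('n))"
proof -
  let ?m = "cube_mean b (cube a s)"
  have "(\<integral>\<^sup>+y\<in>cube a s. ennreal \<bar>b y - m\<bar> \<partial>lebesgue)
      \<le> (\<integral>\<^sup>+y. ennreal \<bar>b y - ?m\<bar> * indicator (cube a s) y + ennreal \<bar>?m - m\<bar> * indicator (cube a s) y \<partial>lebesgue)"
    by (intro nn_integral_mono) (auto split: split_indicator simp flip: ennreal_plus)
  also have "\<dots> = (\<integral>\<^sup>+y\<in>cube a s. ennreal \<bar>b y - ?m\<bar> \<partial>lebesgue) + ennreal \<bar>?m - m\<bar> * emeasure lebesgue (cube a s)"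
    by (simp add: nn_integral_add nn_integral_cmult)
  also have "\<dots> \<le> ennreal (B * s ^ CARD('n)) + ennreal \<bar>?m - m\<bar> * ennreal (s ^ CARD('n))"
    using osc[OF s, of a] s by (simp add: emeasure_cube add_right_mono)
  also have "\<dots> = ennreal ((B + \<bar>?m - m\<bar>) * s ^ CARD('n))"
    using B_pos s by (simp add: distrib_right flip: ennreal_plus ennreal_mult)
  finally show ?thesis .
qed

text \<open>The differentiation theorem at hand averages over cubes with lower corner \<open>x\<close>. Such cubes
  leave \<open>cube a s\<close>, so the stopping argument takes place in \<open>cube a (2 * s)\<close>; the stopping scale
  is the largest \<open>s / 2 ^ k\<close> at which the mean oscillation exceeds the level \<open>L\<close>.\<close>

lemma stopping_cubes:
  obtains K where "K > 0" "\<And>a s. s > 0 \<Longrightarrow> \<exists>C. countable C \<and> (\<forall>(y, h)\<in>C. h > 0) \<and>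
    (\<integral>\<^sup>+(y, h). emeasure lebesgue (dilate y h) \<partial>count_space C) \<le> ennreal (s ^ CARD('n) / 2) \<and>
    (\<forall>(y, h)\<in>C. \<bar>cube_mean b (dilate y h) - cube_mean b (cube a s)\<bar> \<le> K) \<and>
    (AE x in lebesgue. x \<in> cube a s \<and> \<bar>b x - cube_mean b (cube a s)\<bar> > K \<longrightarrow> (\<exists>(y, h)\<in>C. x \<in> dilate y h))"
proof -
  let ?n = "CARD('n)"
  \<comment> \<open>\<open>D\<close> is the volume ratio of a dilate to its cube, and
    \<open>G * s ^ ?n\<close> bounds the integral of \<open>\<bar>b - m\<bar>\<close> over the
    doubled cube. The factor 2 in \<open>L\<close> lets the dilates occupy at most half of the
    volume of \<open>cube a s\<close>. In \<open>K\<close>, the first summand pays for passing from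
    a doubled stopping cube to the dilate, whose side is \<open>5 * real ?n\<close> times as
    long.\<close>
  define D where "D = (10 * real ?n) ^ ?n"
  define G where "G = B * (1 + 2 ^ ?n) * 2 ^ ?n"
  define L where "L = 2 * D * G"
  define K where "K = B * (5 * real ?n) ^ ?n + L"
  have n1: "real ?n \<ge> 1" by (simp add: Suc_le_eq)
  have D1: "D \<ge> 1" unfolding D_def using n1 by (intro one_le_power) linarith
  have G0: "G > 0" unfolding G_def using B_pos by (simp add: add_pos_pos)
  have L0: "L > 0" "G \<le> L" unfolding L_def using D1 G0 by (auto simp: mult_le_cancel_right1)
  have KL: "K \<ge> L" "K > 0" unfolding K_def using B_pos L0 by (auto simp: add_nonneg_pos)
  show thesis
  proof (rule that[OF KL(2)])
    fix a :: "real ^ 'n" and s :: real assume s: "s > 0"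
    define m where "m = cube_mean b (cube a s)"
    define g where "g = (\<lambda>x. \<bar>b x - m\<bar>)"
    define T where "T = cube a (2 * s)"
    have gloc: "locally_integrable g" unfolding g_def by (rule locally_integrable_abs_diff[OF loc])
    have gm [measurable]: "g \<in> borel_measurable lebesgue" by (simp add: g_def)
    have g0: "g x \<ge> 0" for x by (simp add: g_def)
    have QT: "cube a s \<subseteq> T" unfolding T_def using s by (intro cube_subset_cubeI) auto
    have T: "(\<integral>\<^sup>+x\<in>T. ennreal (g x) \<partial>lebesgue) \<le> ennreal (G * s ^ ?n)"
    proof -
      have "\<bar>m - cube_mean b T\<bar> \<le> B * (2 * s / s) ^ ?n"
        unfolding m_def T_def using QT s by (intro mean_diff_subcube) (auto simp: T_def)
      then have "(B + \<bar>cube_mean b T - m\<bar>) * (2 * s) ^ ?n \<le> (B + B * 2 ^ ?n) * (2 * s) ^ ?n"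
        using s by (intro mult_right_mono) (auto simp: abs_minus_commute)
      also have "\<dots> = G * s ^ ?n" by (simp add: G_def power_mult_distrib algebra_simps)
      finally show ?thesis
        using osc_about_le[where s = "2 * s" and a = a and m = m] s unfolding g_def T_def
        by (meson ennreal_leI order_trans zero_less_mult_iff zero_less_numeral)
    qed
    have avg: "(\<integral>\<^sup>+x\<in>cube y h. ennreal (g x) \<partial>lebesgue) = ennreal (cube_mean g (cube y h) * h ^ ?n)" if "h > 0" for y h
      using that nn_integral_cube_eq[OF gloc g0] by (simp add: cube_mean_def measure_cube)
    \<comment> \<open>The bound on the doubled cube records that the scale is the largest possible;
      it is what keeps the means over the dilates close to \<open>m\<close>.\<close>
    define F where "F = {(y, h). 0 < h \<and> cube y h \<subseteq> T \<and> L < cube_mean g (cube y h) \<and> cube_mean g (cube y (2 * h)) \<le> L}"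
    \<comment> \<open>With this \<open>H\<close>, a mean above \<open>L\<close> on a cube inside
      \<open>T\<close> implies the domination hypothesis of \<open>weak_type_cubes\<close>.\<close>
    define H where "H = (\<lambda>x. ennreal (1 / L) * (ennreal (g x) * indicator T x))"
    have Hm: "H \<in> borel_measurable lebesgue" by (simp add: H_def T_def)
    have HI: "(\<integral>\<^sup>+x. H x \<partial>lebesgue) \<le> ennreal (1 / L) * ennreal (G * s ^ ?n)"
      unfolding H_def using T by (subst nn_integral_cmult) (auto simp: T_def intro: mult_left_mono)
    have Hfin: "(\<integral>\<^sup>+x. H x \<partial>lebesgue) < \<infinity>"
      by (rule order_le_less_trans[OF HI]) (simp add: ennreal_mult_less_top)
    have HF: "0 < h \<and> emeasure lebesgue (cube y h) \<le> (\<integral>\<^sup>+x\<in>cube y h. H x \<partial>lebesgue)" if yh: "(y, h) \<in> F" for y h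
    proof
      show h: "0 < h" using yh by (simp add: F_def)
      have sub: "cube y h \<subseteq> T" and L: "L < cube_mean g (cube y h)" using yh by (auto simp: F_def)
      have "(\<integral>\<^sup>+x\<in>cube y h. H x \<partial>lebesgue) = (\<integral>\<^sup>+x. ennreal (1 / L) * (ennreal (g x) * indicator (cube y h) x) \<partial>lebesgue)"
        using sub by (intro nn_integral_cong) (auto simp: H_def split: split_indicator)
      also have "\<dots> = ennreal (1 / L) * ennreal (cube_mean g (cube y h) * h ^ ?n)"
        using avg[OF h] by (subst nn_integral_cmult) auto
      also have "\<dots> = ennreal (cube_mean g (cube y h) / L * h ^ ?n)"
        using L0 L h by (simp flip: ennreal_mult)
      also have "\<dots> \<ge> ennreal (1 * h ^ ?n)"
        using L0 L h by (intro ennreal_leI mult_right_mono) auto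
      finally show "emeasure lebesgue (cube y h) \<le> (\<integral>\<^sup>+x\<in>cube y h. H x \<partial>lebesgue)"
        using h by (simp add: emeasure_cube)
    qed
    obtain C where C: "countable C" "C \<subseteq> F"
      "\<And>y h. (y, h) \<in> F \<Longrightarrow> \<exists>(y', h') \<in> C. cube y h \<subseteq> dilate y' h'"
      "(\<integral>\<^sup>+(y, h). emeasure lebesgue (dilate y h) \<partial>count_space C) \<le> ennreal D * (\<integral>\<^sup>+x. H x \<partial>lebesgue)"
      unfolding D_def by (rule weak_type_cubes[of H F]) (use Hm Hfin HF in blast)+
    have "(\<integral>\<^sup>+(y, h). emeasure lebesgue (dilate y h) \<partial>count_space C) \<le> ennreal D * (ennreal (1 / L) * ennreal (G * s ^ ?n))"
      using C(4) HI by (meson mult_left_mono order_trans zero_le)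
    also have "\<dots> = ennreal (D * (1 / L * (G * s ^ ?n)))"
      using D1 L0 G0 s by (simp flip: ennreal_mult)
    also have "D * (1 / L * (G * s ^ ?n)) = s ^ ?n / 2"
      using D1 G0 by (simp add: L_def)
    finally have sum: "(\<integral>\<^sup>+(y, h). emeasure lebesgue (dilate y h) \<partial>count_space C) \<le> ennreal (s ^ ?n / 2)" .
    have means: "\<bar>cube_mean b (dilate y h) - m\<bar> \<le> K" if "(y, h) \<in> C" for y h
    proof -
      have h: "h > 0" and avg2: "cube_mean g (cube y (2 * h)) \<le> L" using that C(2) by (auto simp: F_def)
      have hn: "5 * h \<le> 5 * real ?n * h" "10 * real ?n * h = 2 * (5 * real ?n * h)" using n1 h by simp_all
      have "cube y (2 * h) \<subseteq> dilate y h"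
        unfolding dilate_def using h hn by (intro cube_subset_cubeI; simp only: vec_lambda_beta; linarith)
      then have "\<bar>cube_mean b (cube y (2 * h)) - cube_mean b (dilate y h)\<bar> \<le> B * (10 * real ?n * h / (2 * h)) ^ ?n"
        unfolding dilate_def using h by (intro mean_diff_subcube) auto
      also have "10 * real ?n * h / (2 * h) = 5 * real ?n" using h by simp
      finally have 1: "\<bar>cube_mean b (cube y (2 * h)) - cube_mean b (dilate y h)\<bar> \<le> B * (5 * real ?n) ^ ?n" .
      have "ennreal (\<bar>cube_mean b (cube y (2 * h)) - m\<bar> * (2 * h) ^ ?n) \<le> (\<integral>\<^sup>+x\<in>cube y (2 * h). ennreal (g x) \<partial>lebesgue)"
        unfolding g_def using h by (intro mean_diff_le[OF loc]) simp
      also have "\<dots> = ennreal (cube_mean g (cube y (2 * h)) * (2 * h) ^ ?n)" using h by (intro avg) simp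
      also have "\<dots> \<le> ennreal (L * (2 * h) ^ ?n)" using h avg2 by (intro ennreal_leI mult_right_mono) auto
      finally have "\<bar>cube_mean b (cube y (2 * h)) - m\<bar> * (2 * h) ^ ?n \<le> L * (2 * h) ^ ?n"
        using L0 h by (subst (asm) ennreal_le_iff) auto
      then have 2: "\<bar>cube_mean b (cube y (2 * h)) - m\<bar> \<le> L" using h by simp
      show ?thesis using 1 2 unfolding K_def by linarith
    qed
    have cov: "AE x in lebesgue. x \<in> cube a s \<and> \<bar>b x - m\<bar> > K \<longrightarrow> (\<exists>(y, h)\<in>C. x \<in> dilate y h)"
      using lebesgue_differentiation_cube[OF gloc]
    proof eventually_elim
      case (elim x)
      show ?case
      proof
        assume x: "x \<in> cube a s \<and> \<bar>b x - m\<bar> > K"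
        then have "L < g x" using KL by (simp add: g_def)
        then obtain d where d: "d > 0" "\<And>h. 0 < h \<Longrightarrow> h < d \<Longrightarrow> L < cube_mean g (cube x h)"
          using elim by blast
        obtain k where k: "(1 / 2) ^ k < d / s"
          using real_arch_pow_inv[of "d / s" "1 / 2"] d(1) s by auto
        have "L < cube_mean g (cube x (s / 2 ^ k))"
          using k s by (intro d) (auto simp: power_one_over field_simps)
        define j where "j = (LEAST k. L < cube_mean g (cube x (s / 2 ^ k)))"
        have j: "L < cube_mean g (cube x (s / 2 ^ j))" unfolding j_def by (rule LeastI) fact
        have sub: "cube x (s / 2 ^ i) \<subseteq> T" for i
        proof -
          have "s / 2 ^ i \<le> s" using s by (simp add: field_simps)
          then show ?thesis using x unfolding T_def mem_cube
            by (intro cube_subset_cubeI) (auto, smt (verit, best))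
        qed
        \<comment> \<open>At scale \<open>s\<close> the cube still lies in \<open>T\<close>, so its
          mean is at most \<open>G \<le> L\<close>. Hence the stopping scale is smaller, and the
          doubled stopping cube is one of the scales where the mean did not exceed
          \<open>L\<close>.\<close>
        have "j \<noteq> 0"
        proof
          assume "j = 0"
          with j have "L < cube_mean g (cube x s)" by simp
          moreover have "ennreal (cube_mean g (cube x s) * s ^ ?n) \<le> ennreal (G * s ^ ?n)"
          proof -
            have "ennreal (cube_mean g (cube x s) * s ^ ?n) = (\<integral>\<^sup>+x\<in>cube x s. ennreal (g x) \<partial>lebesgue)"
              using avg[OF s] by simp
            also have "\<dots> \<le> (\<integral>\<^sup>+x\<in>T. ennreal (g x) \<partial>lebesgue)"
              using sub[of 0] by (intro nn_integral_mono) (auto split: split_indicator)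
            finally show ?thesis using T by (rule order_trans)
          qed
          then have "cube_mean g (cube x s) \<le> G"
            using G0 s by (subst (asm) ennreal_le_iff) auto
          ultimately show False using L0 by simp
        qed
        then obtain i where i: "j = Suc i" by (cases j) auto
        then have "\<not> L < cube_mean g (cube x (s / 2 ^ i))"
          unfolding j_def by (metis lessI not_less_Least)
        then have "(x, s / 2 ^ j) \<in> F" using sub[of j] j s i by (auto simp: F_def)
        then obtain y h where "(y, h) \<in> C" "cube x (s / 2 ^ j) \<subseteq> dilate y h" using C(3) by blast
        moreover have "x \<in> cube x (s / 2 ^ j)" using s by (intro corner_in_cube) simp
        ultimately show "\<exists>(y, h)\<in>C. x \<in> dilate y h" by blast
      qed
    qed
    show "\<exists>C. countable C \<and> (\<forall>(y, h)\<in>C. h > 0) \<and>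
      (\<integral>\<^sup>+(y, h). emeasure lebesgue (dilate y h) \<partial>count_space C) \<le> ennreal (s ^ ?n / 2) \<and>
      (\<forall>(y, h)\<in>C. \<bar>cube_mean b (dilate y h) - cube_mean b (cube a s)\<bar> \<le> K) \<and>
      (AE x in lebesgue. x \<in> cube a s \<and> \<bar>b x - cube_mean b (cube a s)\<bar> > K \<longrightarrow> (\<exists>(y, h)\<in>C. x \<in> dilate y h))"
      using C(1,2) sum means cov unfolding m_def by (intro exI[of _ C]) (auto simp: F_def)
  qed
qed

text \<open>The truncation at \<open>N\<close> gives an a priori bound; each passage to the stopping cubes maps a
  bound \<open>M\<close> for the exponential means of all cubes to \<open>4/3 * (1 + M / 2)\<close>, whose fixed point is 4.\<close>

lemma exp_trunc_bound:
  obtains c where "c > 0" "\<And>N a s j. N > 0 \<Longrightarrow> s > 0 \<Longrightarrow>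
    (\<integral>\<^sup>+x\<in>cube a s. ennreal (exp (c * min \<bar>b x - cube_mean b (cube a s)\<bar> N)) \<partial>lebesgue)
      \<le> ennreal ((4 + (2/3) ^ j * exp (c * N)) * s ^ CARD('n))"
proof -
  obtain K where K: "K > 0" and stop: "\<And>a s. s > 0 \<Longrightarrow> \<exists>C. countable C \<and> (\<forall>(y, h)\<in>C. h > 0) \<and>
    (\<integral>\<^sup>+(y, h). emeasure lebesgue (dilate y h) \<partial>count_space C) \<le> ennreal (s ^ CARD('n) / 2) \<and>
    (\<forall>(y, h)\<in>C. \<bar>cube_mean b (dilate y h) - cube_mean b (cube a s)\<bar> \<le> K) \<and>
    (AE x in lebesgue. x \<in> cube a s \<and> \<bar>b x - cube_mean b (cube a s)\<bar> > K \<longrightarrow> (\<exists>(y, h)\<in>C. x \<in> dilate y h))"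
    by (rule stopping_cubes) blast
  \<comment> \<open>Any value of \<open>exp (c * K)\<close> strictly between 1 and 2 would do: the
    dilates carry at most half of the volume, so the recursion contracts by the factor
    \<open>exp (c * K) / 2\<close>, here 2/3.\<close>
  define c where "c = ln (4/3) / K"
  have c: "c > 0" "exp (c * K) = 4/3" using K by (simp_all add: c_def)
  show thesis
  proof (rule that[OF c(1)])
    fix N :: real and a s j assume N: "N > 0" and s: "s > (0::real)"
    define \<phi> where "\<phi> Q x = ennreal (exp (c * min \<bar>b x - cube_mean b Q\<bar> N))" for Q x
    have m [measurable]: "\<phi> Q \<in> borel_measurable lebesgue" for Q unfolding \<phi>_def[abs_def] by measurable
    \<comment> \<open>All cubes are treated at once in the induction, because the stopping dilates
      need not lie in \<open>cube a s\<close>.\<close>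
    have "(\<integral>\<^sup>+x\<in>cube a s. \<phi> (cube a s) x \<partial>lebesgue) \<le> ennreal ((4 + (2/3) ^ j * exp (c * N)) * s ^ CARD('n))"
      using s
    proof (induction j arbitrary: a s)
      case 0
      have "(\<integral>\<^sup>+x\<in>cube a s. \<phi> (cube a s) x \<partial>lebesgue) \<le> (\<integral>\<^sup>+x\<in>cube a s. ennreal (4 + exp (c * N)) \<partial>lebesgue)"
      proof (intro nn_integral_mono mult_right_mono)
        fix x
        have "exp (c * min \<bar>b x - cube_mean b (cube a s)\<bar> N) \<le> exp (c * N)" using c by simp
        then show "\<phi> (cube a s) x \<le> ennreal (4 + exp (c * N))" unfolding \<phi>_def by (intro ennreal_leI) linarith
      qed simp
      also have "\<dots> = ennreal ((4 + exp (c * N)) * s ^ CARD('n))"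
        using 0 by (simp add: nn_integral_cmult emeasure_cube add_nonneg_nonneg ennreal_mult)
      finally show ?case by simp
    next
      case (Suc j)
      let ?m = "cube_mean b (cube a s)"
      define M where "M = 4 + (2/3) ^ j * exp (c * N)"
      have M: "M > 0" unfolding M_def by (intro add_pos_pos) auto
      obtain C where C0: "countable C" "\<forall>(y, h)\<in>C. h > 0"
        "(\<integral>\<^sup>+(y, h). emeasure lebesgue (dilate y h) \<partial>count_space C) \<le> ennreal (s ^ CARD('n) / 2)"
        "\<forall>(y, h)\<in>C. \<bar>cube_mean b (dilate y h) - ?m\<bar> \<le> K"
        "AE x in lebesgue. x \<in> cube a s \<and> \<bar>b x - ?m\<bar> > K \<longrightarrow> (\<exists>(y, h)\<in>C. x \<in> dilate y h)"
        using stop[OF Suc.prems, of a] by blast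
      have C: "countable C" "\<And>y h. (y, h) \<in> C \<Longrightarrow> h > 0"
        "(\<integral>\<^sup>+(y, h). emeasure lebesgue (dilate y h) \<partial>count_space C) \<le> ennreal (s ^ CARD('n) / 2)"
        "\<And>y h. (y, h) \<in> C \<Longrightarrow> \<bar>cube_mean b (dilate y h) - ?m\<bar> \<le> K"
        "AE x in lebesgue. x \<in> cube a s \<and> \<bar>b x - ?m\<bar> > K \<longrightarrow> (\<exists>(y, h)\<in>C. x \<in> dilate y h)"
        using C0 by (simp_all add: Ball_def)
      define \<psi> where "\<psi> i x = \<phi> (case i of (y, h) \<Rightarrow> dilate y h) x * indicator (case i of (y, h) \<Rightarrow> dilate y h) x" for i x
      have mpsi: "\<psi> i \<in> borel_measurable lebesgue" for i
        unfolding \<psi>_def by (cases i) simp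
      have msum: "(\<lambda>x. \<integral>\<^sup>+i. \<psi> i x \<partial>count_space C) \<in> borel_measurable lebesgue"
      proof (rule sigma_finite_measure.borel_measurable_nn_integral[OF sigma_finite_measure_count_space_countable[OF C(1)]])
        have "(\<lambda>(i, x). \<psi> i x) \<in> borel_measurable (count_space C \<Otimes>\<^sub>M lebesgue)"
          using mpsi C(1) by (intro measurable_pair_measure_countable1) auto
        from measurable_pair_swap[OF this]
        show "(\<lambda>(x, i). \<psi> i x) \<in> borel_measurable (lebesgue \<Otimes>\<^sub>M count_space C)" by (simp add: case_prod_beta')
      qed
      have "(\<integral>\<^sup>+x\<in>cube a s. \<phi> (cube a s) x \<partial>lebesgue)
         \<le> (\<integral>\<^sup>+x. ennreal (4/3) * (indicator (cube a s) x + (\<integral>\<^sup>+i. \<psi> i x \<partial>count_space C)) \<partial>lebesgue)"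
      proof (rule nn_integral_mono_AE)
        show "AE x in lebesgue. \<phi> (cube a s) x * indicator (cube a s) x
           \<le> ennreal (4/3) * (indicator (cube a s) x + (\<integral>\<^sup>+i. \<psi> i x \<partial>count_space C))"
          using C(5)
        proof eventually_elim
          case (elim x)
          consider "x \<notin> cube a s" | "x \<in> cube a s" "\<bar>b x - ?m\<bar> \<le> K" | "x \<in> cube a s" "\<bar>b x - ?m\<bar> > K" by linarith
          then show ?case
          proof cases
            case 2
            have "exp (c * min \<bar>b x - ?m\<bar> N) \<le> exp (c * K)" using c 2 by simp
            then have "\<phi> (cube a s) x \<le> ennreal (4/3)" unfolding \<phi>_def c(2) by (rule ennreal_leI)
            also have "\<dots> * 1 \<le> ennreal (4/3) * (1 + (\<integral>\<^sup>+i. \<psi> i x \<partial>count_space C))"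
              by (intro mult_left_mono) auto
            finally show ?thesis using 2 by simp
          next
            case 3
            then obtain y h where yh: "(y, h) \<in> C" "x \<in> dilate y h" using elim by auto
            \<comment> \<open>Truncation respects the triangle inequality because \<open>K\<close>
              stands outside the minimum and is nonnegative.\<close>
            have "min \<bar>b x - ?m\<bar> N \<le> K + min \<bar>b x - cube_mean b (dilate y h)\<bar> N"
              using C(4)[OF yh(1)] K by linarith
            then have "c * min \<bar>b x - ?m\<bar> N \<le> c * (K + min \<bar>b x - cube_mean b (dilate y h)\<bar> N)"
              using c(1) by (intro mult_left_mono) auto
            then have "exp (c * min \<bar>b x - ?m\<bar> N) \<le> exp (c * K) * exp (c * min \<bar>b x - cube_mean b (dilate y h)\<bar> N)"
              by (simp add: distrib_left flip: exp_add)
            then have "\<phi> (cube a s) x \<le> ennreal (4/3 * exp (c * min \<bar>b x - cube_mean b (dilate y h)\<bar> N))"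
              unfolding \<phi>_def c(2) by (rule ennreal_leI)
            also have "\<dots> = ennreal (4/3) * \<psi> (y, h) x"
              using yh(2) ennreal_mult[of "4/3" "exp (c * min \<bar>b x - cube_mean b (dilate y h)\<bar> N)"]
              by (simp add: \<psi>_def \<phi>_def)
            also have "\<dots> \<le> ennreal (4/3) * (\<integral>\<^sup>+i. \<psi> i x \<partial>count_space C)"
              by (intro mult_left_mono nn_integral_ge_point[OF yh(1)]) simp
            also have "\<dots> \<le> ennreal (4/3) * (1 + (\<integral>\<^sup>+i. \<psi> i x \<partial>count_space C))"
              by (intro mult_left_mono) auto
            finally show ?thesis using 3 by simp
          qed simp
        qed
      qed
      also have "\<dots> = ennreal (4/3) * (emeasure lebesgue (cube a s) + (\<integral>\<^sup>+x. \<integral>\<^sup>+i. \<psi> i x \<partial>count_space C \<partial>lebesgue))"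
        using msum by (simp add: nn_integral_cmult nn_integral_add)
      also have "(\<integral>\<^sup>+x. \<integral>\<^sup>+i. \<psi> i x \<partial>count_space C \<partial>lebesgue) = (\<integral>\<^sup>+i. \<integral>\<^sup>+x. \<psi> i x \<partial>lebesgue \<partial>count_space C)"
        using C(1) mpsi by (rule nn_integral_count_space_nn_integral)
      also have "\<dots> \<le> (\<integral>\<^sup>+i. ennreal M * (case i of (y, h) \<Rightarrow> emeasure lebesgue (dilate y h)) \<partial>count_space C)"
      proof (rule nn_integral_mono)
        fix i assume "i \<in> space (count_space C)"
        then obtain y h where i: "i = (y, h)" "h > 0" using C(2) by (cases i) auto
        show "(\<integral>\<^sup>+x. \<psi> i x \<partial>lebesgue) \<le> ennreal M * (case i of (y, h) \<Rightarrow> emeasure lebesgue (dilate y h))"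
          using Suc.IH[of "10 * real CARD('n) * h"] i M
          by (simp add: \<psi>_def dilate_def emeasure_cube M_def ennreal_mult)
      qed
      also have "\<dots> = ennreal M * (\<integral>\<^sup>+(y, h). emeasure lebesgue (dilate y h) \<partial>count_space C)"
        by (rule nn_integral_cmult) simp
      also have "\<dots> \<le> ennreal M * ennreal (s ^ CARD('n) / 2)" using C(3) by (intro mult_left_mono) auto
      finally have "(\<integral>\<^sup>+x\<in>cube a s. \<phi> (cube a s) x \<partial>lebesgue)
        \<le> ennreal (4/3) * (ennreal (s ^ CARD('n)) + ennreal M * ennreal (s ^ CARD('n) / 2))"
        using Suc.prems by (simp add: emeasure_cube add_left_mono mult_left_mono)
      also have "\<dots> = ennreal (4/3 * (s ^ CARD('n) + M * (s ^ CARD('n) / 2)))"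
        using M Suc.prems by (simp flip: ennreal_mult ennreal_plus)
      also have "4/3 * (s ^ CARD('n) + M * (s ^ CARD('n) / 2)) = (4 + (2/3) ^ Suc j * exp (c * N)) * s ^ CARD('n)"
        unfolding M_def by (simp add: algebra_simps)
      finally show ?case .
    qed
    then show "(\<integral>\<^sup>+x\<in>cube a s. ennreal (exp (c * min \<bar>b x - cube_mean b (cube a s)\<bar> N)) \<partial>lebesgue)
      \<le> ennreal ((4 + (2/3) ^ j * exp (c * N)) * s ^ CARD('n))" by (simp add: \<phi>_def)
  qed
qed

text \<open>For a fixed truncation level the error term \<open>(2/3) ^ j * exp (c * N)\<close>
  vanishes as \<open>j\<close> grows; only then is the level sent to infinity, by monotone
  convergence. The exponential integral form serves both Chebyshev's and Young's inequality
  directly.\<close>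

lemma john_nirenberg:
  obtains c where "c > 0" "\<And>a s. s > 0 \<Longrightarrow>
    (\<integral>\<^sup>+x\<in>cube a s. ennreal (exp (c * \<bar>b x - cube_mean b (cube a s)\<bar>)) \<partial>lebesgue) \<le> ennreal (4 * s ^ CARD('n))"
proof -
  obtain c where c: "c > 0" and tr: "\<And>N a s j. N > 0 \<Longrightarrow> s > 0 \<Longrightarrow>
    (\<integral>\<^sup>+x\<in>cube a s. ennreal (exp (c * min \<bar>b x - cube_mean b (cube a s)\<bar> N)) \<partial>lebesgue)
      \<le> ennreal ((4 + (2/3) ^ j * exp (c * N)) * s ^ CARD('n))"
    by (rule exp_trunc_bound) blast
  show thesis
  proof (rule that[OF c])
    fix a :: "real ^ 'n" and s :: real assume s: "s > 0"
    define g where "g x = \<bar>b x - cube_mean b (cube a s)\<bar>" for x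
    have gm [measurable]: "g \<in> borel_measurable lebesgue" unfolding g_def[abs_def] by measurable
    let ?f = "\<lambda>k x. ennreal (exp (c * min (g x) (real (Suc k)))) * indicator (cube a s) x"
    have bd: "(\<integral>\<^sup>+x. ?f k x \<partial>lebesgue) \<le> ennreal (4 * s ^ CARD('n))" for k
    proof (rule tendsto_lowerbound)
      have "(\<lambda>j. (4 + (2/3) ^ j * exp (c * real (Suc k))) * s ^ CARD('n)) \<longlonglongrightarrow> (4 + 0 * exp (c * real (Suc k))) * s ^ CARD('n)"
        by (intro tendsto_intros LIMSEQ_power_zero) simp
      then show "(\<lambda>j. ennreal ((4 + (2/3) ^ j * exp (c * real (Suc k))) * s ^ CARD('n))) \<longlonglongrightarrow> ennreal (4 * s ^ CARD('n))"
        by (intro tendsto_ennrealI) simp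
      show "eventually (\<lambda>j. (\<integral>\<^sup>+x. ?f k x \<partial>lebesgue) \<le> ennreal ((4 + (2/3) ^ j * exp (c * real (Suc k))) * s ^ CARD('n))) sequentially"
        using tr[of "real (Suc k)" s a] s by (simp add: g_def)
    qed simp
    have "(\<integral>\<^sup>+x\<in>cube a s. ennreal (exp (c * g x)) \<partial>lebesgue) \<le> (\<integral>\<^sup>+x. (SUP k. ?f k x) \<partial>lebesgue)"
    proof (rule nn_integral_mono)
      fix x
      obtain k where "g x \<le> real k" using real_arch_simple by blast
      then have "min (g x) (real (Suc k)) = g x" by simp
      then have "ennreal (exp (c * g x)) * indicator (cube a s) x = ?f k x" by simp
      also have "\<dots> \<le> (SUP k. ?f k x)" by (rule SUP_upper) simp
      finally show "ennreal (exp (c * g x)) * indicator (cube a s) x \<le> (SUP k. ?f k x)" .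
    qed
    also have "\<dots> = (SUP k. \<integral>\<^sup>+x. ?f k x \<partial>lebesgue)"
    proof (rule nn_integral_monotone_convergence_SUP)
      show "incseq ?f"
        using c by (auto simp: incseq_def le_fun_def min_def intro!: mult_right_mono ennreal_leI)
    qed simp
    also have "\<dots> \<le> ennreal (4 * s ^ CARD('n))" using bd by (rule SUP_least)
    finally show "(\<integral>\<^sup>+x\<in>cube a s. ennreal (exp (c * \<bar>b x - cube_mean b (cube a s)\<bar>)) \<partial>lebesgue) \<le> ennreal (4 * s ^ CARD('n))"
      by (simp add: g_def)
  qed
qed

end

subsection \<open>Weak type estimates\<close>

text \<open>Bernoulli's inequality for the \<open>k\<close>-th power of \<open>exp (u / k)\<close>.
  Dividing the exponent by \<open>k\<close> divides the bound on the excess of an exponential mean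
  over 1 by \<open>k\<close>, so that excess can be made small.\<close>

lemma exp_excess_le:
  fixes u :: real
  assumes "k \<ge> 1"
  shows "real k * (exp (u / real k) - 1) + 1 \<le> exp u"
  using Bernoulli_inequality[of "exp (u / real k) - 1" k] assms by (simp add: flip: exp_of_nat_mult)

lemma log_plus_nonneg: "log_plus t \<ge> 0"
  by (simp add: log_plus_def)

lemma log_plus_mult_le:
  assumes "s \<ge> 0" "t \<ge> 0"
  shows "log_plus (s * t) \<le> log_plus s + log_plus t"
  using assms by (auto simp: log_plus_def ln_mult zero_less_mult_iff)

lemma log_plus_measurable [measurable]: "log_plus \<in> borel_measurable borel"
  unfolding log_plus_def[abs_def] by measurable

text \<open>The tangent lines of the exponential lie below it: the one at 0 serves
  \<open>s \<le> 1\<close>, the one at \<open>ln s\<close> serves \<open>s > 1\<close>. With the -1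
  the exponential term vanishes at \<open>t = 0\<close>, so its mean over a cube shrinks with the
  exponent.\<close>

lemma young_exp_log:
  assumes "s \<ge> 0" "t \<ge> 0"
  shows "s * t \<le> s * log_plus s + (exp t - 1)"
proof (cases "s \<le> 1")
  case True
  have "s * t \<le> 1 * t" using assms True by (intro mult_right_mono) auto
  also have "\<dots> \<le> exp t - 1" using exp_ge_add_one_self[of t] by linarith
  finally show ?thesis using assms log_plus_nonneg[of s] by (simp add: add_increasing)
next
  case False
  have "s * (1 + (t - ln s)) \<le> s * exp (t - ln s)" using False by (intro mult_left_mono) auto
  also have "\<dots> = exp t" using False by (simp add: exp_diff)
  finally show ?thesis using False by (simp add: log_plus_def algebra_simps)
qed

lemma ennreal_less_divide_iff:
  assumes "v > 0" "l \<ge> 0"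
  shows "ennreal l < X / ennreal v \<longleftrightarrow> ennreal (l * v) < X"
proof (cases X)
  case (real r)
  then show ?thesis using assms by (simp add: divide_ennreal ennreal_less_iff pos_less_divide_eq)
next
  case top
  then show ?thesis using assms by (simp add: ennreal_top_divide)
qed

section \<open>Tails over subcubes and the term with the oscillation at the point\<close>

context bmo
begin

text \<open>A deviation of at least \<open>t\<close> from the mean over a subcube forces a deviation
  of at least \<open>t / 2\<close> from the mean \<open>m\<close> over the whole cube, either of
  \<open>b x\<close> or of the mean over the subcube. Chebyshev's inequality settles the first case
  and covering the second, both with the same \<open>H\<close>, whose integral is at most
  \<open>4 * exp (- (c / 2) * t)\<close> times the volume; the two cases add up to the dilation
  constant plus 1.\<close>

lemma tail_subcubes:
  fixes a :: "real ^ 'n"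
  assumes c: "c > 0" and jn: "\<And>a s. s > 0 \<Longrightarrow>
    (\<integral>\<^sup>+x\<in>cube a s. ennreal (exp (c * \<bar>b x - cube_mean b (cube a s)\<bar>)) \<partial>lebesgue) \<le> ennreal (4 * s ^ CARD('n))"
    and s: "s > 0" and t: "t \<ge> 0"
  shows "\<exists>S. S \<in> sets lebesgue \<and>
    (\<forall>x y h. h > 0 \<and> x \<in> cube y h \<and> cube y h \<subseteq> cube a s \<and> t \<le> \<bar>b x - cube_mean b (cube y h)\<bar> \<longrightarrow> x \<in> S) \<and>
    emeasure lebesgue S \<le> ennreal (4 * ((10 * real CARD('n)) ^ CARD('n) + 1) * exp (- (c / 2) * t)) * emeasure lebesgue (cube a s)"
proof -
  define m where "m = cube_mean b (cube a s)"
  define D where "D = (10 * real CARD('n)) ^ CARD('n)"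
  have D0: "D \<ge> 0" by (simp add: D_def)
  define e where "e = exp (- (c / 2) * t)"
  have e0: "e > 0" by (simp add: e_def)
  define H where "H = (\<lambda>x. ennreal e * (ennreal (exp (c * \<bar>b x - m\<bar>)) * indicator (cube a s) x))"
  have Hm [measurable]: "H \<in> borel_measurable lebesgue" by (simp add: H_def)
  have HI: "(\<integral>\<^sup>+x. H x \<partial>lebesgue) \<le> ennreal e * ennreal (4 * s ^ CARD('n))"
    unfolding H_def using jn[OF s, of a] by (subst nn_integral_cmult) (auto simp: m_def intro: mult_left_mono)
  have Hfin: "(\<integral>\<^sup>+x. H x \<partial>lebesgue) < \<infinity>"
    by (rule order_le_less_trans[OF HI]) (simp add: ennreal_mult_less_top)
  have Hval: "H x = ennreal (exp (c * (\<bar>b x - m\<bar> - t / 2)))" if "x \<in> cube a s" for x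
  proof -
    have "e * exp (c * \<bar>b x - m\<bar>) = exp (c * (\<bar>b x - m\<bar> - t / 2))"
      by (simp add: e_def algebra_simps flip: exp_add)
    then show ?thesis using that e0 by (simp add: H_def flip: ennreal_mult)
  qed
  define S1 where "S1 = {x \<in> cube a s. t / 2 \<le> \<bar>b x - m\<bar>}"
  have S1m: "S1 \<in> sets lebesgue"
  proof -
    have "S1 = cube a s \<inter> {x \<in> space lebesgue. t / 2 \<le> \<bar>b x - m\<bar>}" by (auto simp: S1_def)
    also have "\<dots> \<in> sets lebesgue" by (intro sets.Int sets_cube) measurable
    finally show ?thesis .
  qed
  have "emeasure lebesgue S1 = (\<integral>\<^sup>+x. indicator S1 x \<partial>lebesgue)" using S1m by simp
  also have "\<dots> \<le> (\<integral>\<^sup>+x. H x \<partial>lebesgue)"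
  proof (rule nn_integral_mono)
    fix x
    have "ennreal 1 \<le> H x" if "x \<in> S1"
      using that c by (subst Hval) (auto simp: S1_def intro!: ennreal_leI simp del: ennreal_1)
    then show "indicator S1 x \<le> H x" by (auto split: split_indicator)
  qed
  finally have S1: "emeasure lebesgue S1 \<le> ennreal e * ennreal (4 * s ^ CARD('n))" using HI by (rule order_trans)
  define F where "F = {(y, h). h > 0 \<and> cube y h \<subseteq> cube a s \<and> t / 2 \<le> \<bar>cube_mean b (cube y h) - m\<bar>}"
  have HF: "0 < h \<and> emeasure lebesgue (cube y h) \<le> (\<integral>\<^sup>+x\<in>cube y h. H x \<partial>lebesgue)" if yh: "(y, h) \<in> F" for y h
  proof
    show h: "0 < h" using yh by (simp add: F_def)
    have sub: "cube y h \<subseteq> cube a s" and tm: "t / 2 \<le> \<bar>cube_mean b (cube y h) - m\<bar>" using yh by (auto simp: F_def)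
    let ?v = "h ^ CARD('n)"
    have v: "?v > 0" using h by simp
    \<comment> \<open>Jensen's inequality by hand: for
      \<open>u = c * (\<bar>b x - m\<bar> - t / 2)\<close> the mean over the subcube is nonnegative,
      and \<open>1 + u \<le> exp u\<close>, which is \<open>H x\<close> there. The finite amount
      \<open>c * (t / 2) * ?v\<close> is carried on both sides and cancelled at the end, because
      subtraction in \<open>ennreal\<close> truncates at 0.\<close>
    have "ennreal (c * (t / 2) * ?v) \<le> ennreal c * ennreal (\<bar>cube_mean b (cube y h) - m\<bar> * ?v)"
      using c t v tm by (auto simp flip: ennreal_mult intro!: ennreal_leI)
    also have "\<dots> \<le> ennreal c * (\<integral>\<^sup>+x\<in>cube y h. ennreal \<bar>b x - m\<bar> \<partial>lebesgue)"
      by (intro mult_left_mono mean_diff_le[OF loc h]) simp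
    also have "\<dots> = (\<integral>\<^sup>+x. ennreal c * (ennreal \<bar>b x - m\<bar> * indicator (cube y h) x) \<partial>lebesgue)"
      by (simp add: nn_integral_cmult)
    finally have "ennreal (c * (t / 2) * ?v) + emeasure lebesgue (cube y h)
      \<le> (\<integral>\<^sup>+x. ennreal c * (ennreal \<bar>b x - m\<bar> * indicator (cube y h) x) \<partial>lebesgue) + (\<integral>\<^sup>+x. indicator (cube y h) x \<partial>lebesgue)"
      by (simp add: add_right_mono)
    also have "\<dots> = (\<integral>\<^sup>+x. ennreal c * (ennreal \<bar>b x - m\<bar> * indicator (cube y h) x) + indicator (cube y h) x \<partial>lebesgue)"
      by (simp add: nn_integral_add)
    also have "\<dots> \<le> (\<integral>\<^sup>+x. ennreal (c * (t / 2)) * indicator (cube y h) x + H x * indicator (cube y h) x \<partial>lebesgue)"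
    proof (rule nn_integral_mono)
      fix x
      have "ennreal c * ennreal \<bar>b x - m\<bar> + 1 \<le> ennreal (c * (t / 2)) + H x" if x: "x \<in> cube y h"
      proof -
        have "ennreal (c * \<bar>b x - m\<bar> + 1) \<le> ennreal (c * (t / 2) + exp (c * (\<bar>b x - m\<bar> - t / 2)))"
          using exp_ge_add_one_self[of "c * (\<bar>b x - m\<bar> - t / 2)"]
          by (intro ennreal_leI) (simp add: algebra_simps)
        then show ?thesis using x sub c t by (subst Hval) (auto simp: ennreal_mult ennreal_plus)
      qed
      then show "ennreal c * (ennreal \<bar>b x - m\<bar> * indicator (cube y h) x) + indicator (cube y h) x
        \<le> ennreal (c * (t / 2)) * indicator (cube y h) x + H x * indicator (cube y h) x"
        by (auto split: split_indicator)
    qed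
    also have "\<dots> = ennreal (c * (t / 2) * ?v) + (\<integral>\<^sup>+x\<in>cube y h. H x \<partial>lebesgue)"
      using c t h v by (simp add: nn_integral_add nn_integral_cmult emeasure_cube flip: ennreal_mult)
    finally show "emeasure lebesgue (cube y h) \<le> (\<integral>\<^sup>+x\<in>cube y h. H x \<partial>lebesgue)"
      by (simp add: ennreal_add_left_cancel_le)
  qed
  obtain C where C: "countable C" "C \<subseteq> F"
    "\<And>y h. (y, h) \<in> F \<Longrightarrow> \<exists>(y', h') \<in> C. cube y h \<subseteq> dilate y' h'"
    "(\<integral>\<^sup>+(y, h). emeasure lebesgue (dilate y h) \<partial>count_space C) \<le> ennreal D * (\<integral>\<^sup>+x. H x \<partial>lebesgue)"
    unfolding D_def by (rule weak_type_cubes[of H F]) (use Hm Hfin HF in blast)+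
  define S2 where "S2 = (\<Union>(y, h)\<in>C. dilate y h)"
  have S2m: "S2 \<in> sets lebesgue" unfolding S2_def using C(1) by (intro sets.countable_UN') auto
  have "emeasure lebesgue S2 \<le> (\<integral>\<^sup>+(y, h). emeasure lebesgue (dilate y h) \<partial>count_space C)"
    using emeasure_UN_le_nn_integral[OF C(1), of "\<lambda>(y, h). dilate y h" lebesgue]
    by (simp add: S2_def case_prod_beta')
  also have "\<dots> \<le> ennreal D * (ennreal e * ennreal (4 * s ^ CARD('n)))"
    using C(4) HI by (meson mult_left_mono order_trans zero_le)
  finally have S2: "emeasure lebesgue S2 \<le> ennreal D * (ennreal e * ennreal (4 * s ^ CARD('n)))" .
  show ?thesis
  proof (intro exI[of _ "S1 \<union> S2"] conjI allI impI)
    show "S1 \<union> S2 \<in> sets lebesgue" using S1m S2m by blast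
    have "emeasure lebesgue (S1 \<union> S2) \<le> emeasure lebesgue S1 + emeasure lebesgue S2"
      using S1m S2m by (rule emeasure_subadditive)
    also have "\<dots> \<le> ennreal e * ennreal (4 * s ^ CARD('n)) + ennreal D * (ennreal e * ennreal (4 * s ^ CARD('n)))"
      using S1 S2 by (rule add_mono)
    also have "\<dots> = ennreal (e * (4 * s ^ CARD('n)) + D * (e * (4 * s ^ CARD('n))))"
      using e0 D0 s by (simp flip: ennreal_mult ennreal_plus)
    also have "\<dots> = ennreal (4 * (D + 1) * e * s ^ CARD('n))" by (simp add: algebra_simps)
    also have "\<dots> = ennreal (4 * (D + 1) * e) * emeasure lebesgue (cube a s)"
      using e0 D0 s by (simp add: emeasure_cube flip: ennreal_mult)
    finally show "emeasure lebesgue (S1 \<union> S2) \<le> ennreal (4 * ((10 * real CARD('n)) ^ CARD('n) + 1) * exp (- (c / 2) * t)) * emeasure lebesgue (cube a s)"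
      by (simp add: D_def e_def)
  next
    fix x y h assume x: "h > 0 \<and> x \<in> cube y h \<and> cube y h \<subseteq> cube a s \<and> t \<le> \<bar>b x - cube_mean b (cube y h)\<bar>"
    show "x \<in> S1 \<union> S2"
    proof (cases "t / 2 \<le> \<bar>b x - m\<bar>")
      case True
      then show ?thesis using x by (auto simp: S1_def)
    next
      case False
      then have "t / 2 \<le> \<bar>cube_mean b (cube y h) - m\<bar>" using x by linarith
      then have "(y, h) \<in> F" using x by (simp add: F_def)
      from C(3)[OF this] show ?thesis using x by (auto simp: S2_def)
    qed
  qed
qed

text \<open>Sort the cubes by the integer part \<open>k\<close> of the oscillation. The Vitali covering loses a factor
  linear in \<open>k\<close>, which the exponential tail inside each dilated cube absorbs.\<close>

lemma weak_type_oscillation: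
  obtains C where "C > 0" "\<And>f. f \<in> borel_measurable lebesgue \<Longrightarrow> (\<integral>\<^sup>+x. ennreal \<bar>f x\<bar> \<partial>lebesgue) < \<infinity> \<Longrightarrow>
    \<exists>T\<in>sets lebesgue. emeasure lebesgue T \<le> ennreal C * (\<integral>\<^sup>+x. ennreal \<bar>f x\<bar> \<partial>lebesgue) \<and>
      (\<forall>x y h. h > 0 \<and> x \<in> cube y h \<and>
        ennreal (h ^ CARD('n) / 2) < ennreal \<bar>b x - cube_mean b (cube y h)\<bar> * (\<integral>\<^sup>+z\<in>cube y h. ennreal \<bar>f z\<bar> \<partial>lebesgue)
        \<longrightarrow> x \<in> T)"
proof -
  obtain c where c: "c > 0" and jn: "\<And>a s. s > 0 \<Longrightarrow>
    (\<integral>\<^sup>+x\<in>cube a s. ennreal (exp (c * \<bar>b x - cube_mean b (cube a s)\<bar>)) \<partial>lebesgue) \<le> ennreal (4 * s ^ CARD('n))"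
    by (rule john_nirenberg) blast
  define D where "D = (10 * real CARD('n)) ^ CARD('n)"
  have D0: "D \<ge> 0" by (simp add: D_def)
  \<comment> \<open>\<open>\<alpha> k\<close> is the tail factor of \<open>tail_subcubes\<close> at
    \<open>t = k\<close>. In \<open>w\<close>, the factor \<open>D * (2 * (k + 1))\<close> is the
    cost of covering the cubes whose oscillation at the point is about \<open>k\<close>.\<close>
  define \<alpha> where "\<alpha> k = 4 * (D + 1) * exp (- (c / 2) * real k)" for k
  define w where "w k = \<alpha> k * (D * (2 * (real k + 1)))" for k
  have \<alpha>0: "\<alpha> k \<ge> 0" for k using D0 by (simp add: \<alpha>_def)
  have w0: "w k \<ge> 0" for k unfolding w_def using \<alpha>0 D0 by simp
  have wsum: "summable w"
  proof (rule summable_comparison_test')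
    \<comment> \<open>Half of the decay rate \<open>c / 2\<close> is spent on the linear factor
      \<open>k + 1\<close>, which leaves a geometric series.\<close>
    define q where "q = exp (- (c / 4))"
    show "summable (\<lambda>k. 8 * (D + 1) * D * (4 / c + 1) * q ^ k)"
      using c by (intro summable_mult summable_geometric) (simp add: q_def)
    fix k :: nat
    have "c / 4 * real k \<le> exp (c / 4 * real k)" using exp_ge_add_one_self[of "c / 4 * real k"] by linarith
    then have "real k \<le> 4 / c * exp (c / 4 * real k)" using c by (simp add: field_simps)
    moreover have "1 \<le> exp (c / 4 * real k)" using c by simp
    ultimately have "real k + 1 \<le> (4 / c + 1) * exp (c / 4 * real k)" unfolding distrib_right by linarith
    then have "(real k + 1) * exp (- (c / 2) * real k) \<le> (4 / c + 1) * exp (c / 4 * real k) * exp (- (c / 2) * real k)"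
      by (rule mult_right_mono) simp
    also have "\<dots> = (4 / c + 1) * q ^ k"
      by (simp add: q_def mult.assoc algebra_simps flip: exp_add exp_of_nat_mult)
    finally have "8 * (D + 1) * D * ((real k + 1) * exp (- (c / 2) * real k)) \<le> 8 * (D + 1) * D * ((4 / c + 1) * q ^ k)"
      using D0 by (intro mult_left_mono) auto
    moreover have wk: "w k = 8 * (D + 1) * D * ((real k + 1) * exp (- (c / 2) * real k))"
      by (simp add: w_def \<alpha>_def algebra_simps)
    ultimately show "norm (w k) \<le> 8 * (D + 1) * D * (4 / c + 1) * q ^ k"
      using w0[of k] wk by (simp add: mult.assoc)
  qed
  define C where "C = suminf w + 1"
  have C0: "C > 0" unfolding C_def using suminf_nonneg[OF wsum w0] by simp
  show thesis
  proof (rule that[OF C0])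
    fix f :: "real ^ 'n \<Rightarrow> real"
    assume fm [measurable]: "f \<in> borel_measurable lebesgue" and fin: "(\<integral>\<^sup>+x. ennreal \<bar>f x\<bar> \<partial>lebesgue) < \<infinity>"
    let ?I = "\<integral>\<^sup>+x. ennreal \<bar>f x\<bar> \<partial>lebesgue"
    have "\<exists>T\<in>sets lebesgue. emeasure lebesgue T \<le> ennreal (w k) * ?I \<and>
      (\<forall>x y h. h > 0 \<and> x \<in> cube y h \<and> real k \<le> \<bar>b x - cube_mean b (cube y h)\<bar> \<and>
         emeasure lebesgue (cube y h) \<le> ennreal (2 * (real k + 1)) * (\<integral>\<^sup>+z\<in>cube y h. ennreal \<bar>f z\<bar> \<partial>lebesgue) \<longrightarrow> x \<in> T)" for k
    proof -
      \<comment> \<open>If the oscillation at the point is at most \<open>k + 1\<close> and the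
        product exceeds the level 1/2, then the mean of \<open>\<bar>f\<bar>\<close> is at least
        \<open>1 / (2 * (k + 1))\<close>.\<close>
      define H where "H = (\<lambda>x. ennreal (2 * (real k + 1)) * ennreal \<bar>f x\<bar>)"
      have Hm: "H \<in> borel_measurable lebesgue" by (simp add: H_def)
      have HI: "(\<integral>\<^sup>+x. H x \<partial>lebesgue) = ennreal (2 * (real k + 1)) * ?I"
        by (simp add: H_def nn_integral_cmult)
      have Hfin: "(\<integral>\<^sup>+x. H x \<partial>lebesgue) < \<infinity>" using fin by (simp add: HI ennreal_mult_less_top)
      have HQ: "(\<integral>\<^sup>+x\<in>cube y h. H x \<partial>lebesgue) = ennreal (2 * (real k + 1)) * (\<integral>\<^sup>+z\<in>cube y h. ennreal \<bar>f z\<bar> \<partial>lebesgue)" for y h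
        by (simp add: H_def nn_integral_cmult mult.assoc)
      \<comment> \<open>This family depends on \<open>f\<close> and \<open>k\<close> only. The point
        enters afterwards, through the exceptional set \<open>S i\<close> inside each selected
        dilate.\<close>
      define F where "F = {(y, h). h > 0 \<and> emeasure lebesgue (cube y h) \<le> (\<integral>\<^sup>+x\<in>cube y h. H x \<partial>lebesgue)}"
      have HF: "0 < h \<and> emeasure lebesgue (cube y h) \<le> (\<integral>\<^sup>+x\<in>cube y h. H x \<partial>lebesgue)" if "(y, h) \<in> F" for y h
        using that by (simp add: F_def)
      obtain C where C: "countable C" "C \<subseteq> F"
        "\<And>y h. (y, h) \<in> F \<Longrightarrow> \<exists>(y', h') \<in> C. cube y h \<subseteq> dilate y' h'"
        "(\<integral>\<^sup>+(y, h). emeasure lebesgue (dilate y h) \<partial>count_space C) \<le> ennreal D * (\<integral>\<^sup>+x. H x \<partial>lebesgue)"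
        unfolding D_def by (rule weak_type_cubes[of H F]) (use Hm Hfin HF in blast)+
      have "\<exists>S. \<forall>i\<in>C. S i \<in> sets lebesgue \<and>
         (\<forall>x y h. h > 0 \<and> x \<in> cube y h \<and> cube y h \<subseteq> dilate (fst i) (snd i) \<and> real k \<le> \<bar>b x - cube_mean b (cube y h)\<bar> \<longrightarrow> x \<in> S i) \<and>
         emeasure lebesgue (S i) \<le> ennreal (\<alpha> k) * emeasure lebesgue (dilate (fst i) (snd i))"
      proof (rule bchoice, intro ballI)
        fix i assume "i \<in> C"
        then have pos: "10 * real CARD('n) * snd i > 0" using C(2) by (auto simp: F_def)
        show "\<exists>S. S \<in> sets lebesgue \<and>
         (\<forall>x y h. h > 0 \<and> x \<in> cube y h \<and> cube y h \<subseteq> dilate (fst i) (snd i) \<and> real k \<le> \<bar>b x - cube_mean b (cube y h)\<bar> \<longrightarrow> x \<in> S) \<and>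
         emeasure lebesgue S \<le> ennreal (\<alpha> k) * emeasure lebesgue (dilate (fst i) (snd i))"
          using tail_subcubes[OF c jn pos of_nat_0_le_iff, of "\<chi> j. fst i $ j - 5 * real CARD('n) * snd i" k]
          unfolding dilate_def \<alpha>_def D_def .
      qed
      then obtain S where S: "\<And>i. i \<in> C \<Longrightarrow> S i \<in> sets lebesgue"
        "\<And>i x y h. \<lbrakk>i \<in> C; h > 0; x \<in> cube y h; cube y h \<subseteq> dilate (fst i) (snd i); real k \<le> \<bar>b x - cube_mean b (cube y h)\<bar>\<rbrakk> \<Longrightarrow> x \<in> S i"
        "\<And>i. i \<in> C \<Longrightarrow> emeasure lebesgue (S i) \<le> ennreal (\<alpha> k) * emeasure lebesgue (dilate (fst i) (snd i))"
        by blast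
      show ?thesis
      proof (rule bexI[of _ "\<Union>i\<in>C. S i"], intro conjI allI impI)
        show "(\<Union>i\<in>C. S i) \<in> sets lebesgue" using C(1) S(1) by (intro sets.countable_UN') auto
        have "emeasure lebesgue (\<Union>i\<in>C. S i) \<le> (\<integral>\<^sup>+i. emeasure lebesgue (S i) \<partial>count_space C)"
          using C(1) S(1) by (rule emeasure_UN_le_nn_integral)
        also have "\<dots> \<le> (\<integral>\<^sup>+i. ennreal (\<alpha> k) * (case i of (y, h) \<Rightarrow> emeasure lebesgue (dilate y h)) \<partial>count_space C)"
          using S(3) by (intro nn_integral_mono) (simp add: case_prod_beta')
        also have "\<dots> = ennreal (\<alpha> k) * (\<integral>\<^sup>+(y, h). emeasure lebesgue (dilate y h) \<partial>count_space C)"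
          by (rule nn_integral_cmult) simp
        also have "\<dots> \<le> ennreal (\<alpha> k) * (ennreal D * (ennreal (2 * (real k + 1)) * ?I))"
          using C(4) unfolding HI by (intro mult_left_mono) auto
        also have "\<dots> = ennreal (w k) * ?I"
          using \<alpha>0[of k] D0 by (simp add: w_def ennreal_mult mult.assoc)
        finally show "emeasure lebesgue (\<Union>i\<in>C. S i) \<le> ennreal (w k) * ?I" .
      next
        fix x y h assume x: "h > 0 \<and> x \<in> cube y h \<and> real k \<le> \<bar>b x - cube_mean b (cube y h)\<bar> \<and>
         emeasure lebesgue (cube y h) \<le> ennreal (2 * (real k + 1)) * (\<integral>\<^sup>+z\<in>cube y h. ennreal \<bar>f z\<bar> \<partial>lebesgue)"
        then have "(y, h) \<in> F" by (simp add: F_def HQ)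
        then obtain i where "i \<in> C" "cube y h \<subseteq> dilate (fst i) (snd i)" using C(3) by fastforce
        then show "x \<in> (\<Union>i\<in>C. S i)" using S(2) x by blast
      qed
    qed
    then have "\<forall>k. \<exists>T. T \<in> sets lebesgue \<and> emeasure lebesgue T \<le> ennreal (w k) * ?I \<and>
      (\<forall>x y h. h > 0 \<and> x \<in> cube y h \<and> real k \<le> \<bar>b x - cube_mean b (cube y h)\<bar> \<and>
         emeasure lebesgue (cube y h) \<le> ennreal (2 * (real k + 1)) * (\<integral>\<^sup>+z\<in>cube y h. ennreal \<bar>f z\<bar> \<partial>lebesgue) \<longrightarrow> x \<in> T)"
      by (simp only: Bex_def simp_thms)
    from choice[OF this] obtain T where T: "\<And>k. T k \<in> sets lebesgue" "\<And>k. emeasure lebesgue (T k) \<le> ennreal (w k) * ?I"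
      "\<And>k x y h. \<lbrakk>h > 0; x \<in> cube y h; real k \<le> \<bar>b x - cube_mean b (cube y h)\<bar>;
         emeasure lebesgue (cube y h) \<le> ennreal (2 * (real k + 1)) * (\<integral>\<^sup>+z\<in>cube y h. ennreal \<bar>f z\<bar> \<partial>lebesgue)\<rbrakk> \<Longrightarrow> x \<in> T k"
      by blast
    show "\<exists>T\<in>sets lebesgue. emeasure lebesgue T \<le> ennreal C * ?I \<and>
      (\<forall>x y h. h > 0 \<and> x \<in> cube y h \<and>
        ennreal (h ^ CARD('n) / 2) < ennreal \<bar>b x - cube_mean b (cube y h)\<bar> * (\<integral>\<^sup>+z\<in>cube y h. ennreal \<bar>f z\<bar> \<partial>lebesgue)
        \<longrightarrow> x \<in> T)"
    proof (rule bexI[of _ "\<Union>k. T k"], intro conjI allI impI)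
      show "(\<Union>k. T k) \<in> sets lebesgue" using T(1) by blast
      have "emeasure lebesgue (\<Union>k. T k) \<le> (\<Sum>k. emeasure lebesgue (T k))"
        using T(1) by (intro emeasure_subadditive_countably) auto
      also have "\<dots> \<le> (\<Sum>k. ennreal (w k) * ?I)" using T(2) by (intro suminf_le) auto
      also have "\<dots> = (\<Sum>k. ennreal (w k)) * ?I" by simp
      also have "(\<Sum>k. ennreal (w k)) = ennreal (suminf w)" using w0 wsum by (rule suminf_ennreal2)
      also have "\<dots> * ?I \<le> ennreal C * ?I" by (intro mult_right_mono ennreal_leI) (auto simp: C_def)
      finally show "emeasure lebesgue (\<Union>k. T k) \<le> ennreal C * ?I" .
    next
      fix x y h assume x: "h > 0 \<and> x \<in> cube y h \<and>
        ennreal (h ^ CARD('n) / 2) < ennreal \<bar>b x - cube_mean b (cube y h)\<bar> * (\<integral>\<^sup>+z\<in>cube y h. ennreal \<bar>f z\<bar> \<partial>lebesgue)"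
      let ?u = "\<bar>b x - cube_mean b (cube y h)\<bar>" and ?J = "\<integral>\<^sup>+z\<in>cube y h. ennreal \<bar>f z\<bar> \<partial>lebesgue"
      define k where "k = nat \<lfloor>?u\<rfloor>"
      have k: "real k \<le> ?u" "?u \<le> real k + 1" unfolding k_def by linarith+
      have "ennreal (h ^ CARD('n)) = 2 * ennreal (h ^ CARD('n) / 2)"
        using x by (simp flip: ennreal_numeral ennreal_mult)
      also have "\<dots> \<le> 2 * (ennreal ?u * ?J)" using x by (intro mult_left_mono) auto
      also have "\<dots> \<le> 2 * (ennreal (real k + 1) * ?J)" using k by (intro mult_left_mono mult_right_mono ennreal_leI) auto
      also have "\<dots> = ennreal (2 * (real k + 1)) * ?J"
      proof -
        have "ennreal (2 * (real k + 1)) = 2 * ennreal (real k + 1)" by (subst ennreal_mult) auto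
        then show ?thesis by (simp only: mult.assoc)
      qed
      finally have "emeasure lebesgue (cube y h) \<le> ennreal (2 * (real k + 1)) * ?J" using x by (simp add: emeasure_cube)
      then show "x \<in> (\<Union>k. T k)" using T(3)[of h x y k] x k by blast
    qed
  qed
qed

end

section \<open>The term with the mean of the oscillation against f\<close>

context bmo
begin

lemma weak_type_LlogL:
  obtains C where "C > 0" "\<And>f. f \<in> borel_measurable lebesgue \<Longrightarrow>
    (\<integral>\<^sup>+x. ennreal (\<bar>f x\<bar> * (1 + log_plus \<bar>f x\<bar>)) \<partial>lebesgue) < \<infinity> \<Longrightarrow>
    \<exists>T\<in>sets lebesgue. emeasure lebesgue T \<le> ennreal C * (\<integral>\<^sup>+x. ennreal (\<bar>f x\<bar> * (1 + log_plus \<bar>f x\<bar>)) \<partial>lebesgue) \<and>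
      (\<forall>x y h. h > 0 \<and> x \<in> cube y h \<and>
        ennreal (h ^ CARD('n) / 2) < (\<integral>\<^sup>+z\<in>cube y h. ennreal (\<bar>b z - cube_mean b (cube y h)\<bar> * \<bar>f z\<bar>) \<partial>lebesgue)
        \<longrightarrow> x \<in> T)"
proof -
  obtain c where c: "c > 0" and jn: "\<And>a s. s > 0 \<Longrightarrow>
    (\<integral>\<^sup>+x\<in>cube a s. ennreal (exp (c * \<bar>b x - cube_mean b (cube a s)\<bar>)) \<partial>lebesgue) \<le> ennreal (4 * s ^ CARD('n))"
    by (rule john_nirenberg) blast
  \<comment> \<open>By Bernoulli the mean of \<open>exp (c' * \<bar>b - m\<bar>) - 1\<close> over a
    cube with mean \<open>m\<close> is at most (4 - 1) / 12 = 1/4. This is half of the level 1/2, so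
    the logarithmic term in Young's inequality has to supply the other half.\<close>
  define c' where "c' = c / 12"
  have c': "c' > 0" using c by (simp add: c'_def)
  have jn': "(\<integral>\<^sup>+x\<in>cube a s. ennreal (exp (c' * \<bar>b x - cube_mean b (cube a s)\<bar>) - 1) \<partial>lebesgue) \<le> ennreal (s ^ CARD('n) / 4)"
    if s: "s > 0" for a s
  proof -
    define g where "g x = \<bar>b x - cube_mean b (cube a s)\<bar>" for x
    have gm [measurable]: "g \<in> borel_measurable lebesgue" unfolding g_def[abs_def] by measurable
    have g0: "g x \<ge> 0" for x by (simp add: g_def)
    let ?I = "\<integral>\<^sup>+x\<in>cube a s. ennreal (exp (c' * g x) - 1) \<partial>lebesgue"
    have "ennreal (s ^ CARD('n)) + 12 * ?I
      = (\<integral>\<^sup>+x. indicator (cube a s) x + 12 * (ennreal (exp (c' * g x) - 1) * indicator (cube a s) x) \<partial>lebesgue)"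
      using s by (simp add: nn_integral_add nn_integral_cmult emeasure_cube)
    also have "\<dots> \<le> (\<integral>\<^sup>+x\<in>cube a s. ennreal (exp (c * g x)) \<partial>lebesgue)"
    proof (rule nn_integral_mono)
      fix x
      have "0 \<le> c' * g x" using c' g0 by simp
      then have "1 + 12 * ennreal (exp (c' * g x) - 1) = ennreal (12 * (exp (c' * g x) - 1) + 1)"
        using ennreal_mult[of 12 "exp (c' * g x) - 1"] by (subst ennreal_plus) (auto simp: add.commute)
      also have "\<dots> \<le> ennreal (exp (c * g x))"
        using exp_excess_le[of 12 "c * g x"] by (intro ennreal_leI) (simp add: c'_def)
      finally show "indicator (cube a s) x + 12 * (ennreal (exp (c' * g x) - 1) * indicator (cube a s) x)
        \<le> ennreal (exp (c * g x)) * indicator (cube a s) x"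
        by (auto split: split_indicator)
    qed
    also have "\<dots> \<le> ennreal (4 * s ^ CARD('n))" using jn[OF s, of a] by (simp add: g_def)
    also have "\<dots> = ennreal (s ^ CARD('n)) + 12 * ennreal (s ^ CARD('n) / 4)"
      using s by (simp flip: ennreal_numeral ennreal_mult ennreal_plus)
    finally have le: "12 * ?I \<le> 12 * ennreal (s ^ CARD('n) / 4)" by (simp add: ennreal_add_left_cancel_le)
    then have "?I \<le> ennreal (s ^ CARD('n) / 4)"
      by (subst (asm) ennreal_mult_le_mult_iff) auto
    then show ?thesis by (simp add: g_def)
  qed
  \<comment> \<open>The 4 undoes the remaining 1/4; \<open>1 / c'\<close> comes from Young's
    inequality for the pair \<open>\<bar>f z\<bar> / c'\<close> and
    \<open>c' * \<bar>b z - m\<bar>\<close>; the last factor comes from splitting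
    \<open>log_plus (\<bar>f z\<bar> / c')\<close>.\<close>
  define M where "M = 4 * (1 / c') * (1 + log_plus (1 / c'))"
  have M0: "M > 0" unfolding M_def using c' log_plus_nonneg[of "1 / c'"] by (simp add: add_pos_nonneg)
  define D where "D = (10 * real CARD('n)) ^ CARD('n)"
  have D0: "D > 0" by (simp add: D_def)
  show thesis
  proof (rule that)
    show "D * M > 0" using D0 M0 by simp
    fix f :: "real ^ 'n \<Rightarrow> real"
    let ?J = "\<integral>\<^sup>+x. ennreal (\<bar>f x\<bar> * (1 + log_plus \<bar>f x\<bar>)) \<partial>lebesgue"
    assume fm [measurable]: "f \<in> borel_measurable lebesgue" and fin: "?J < \<infinity>"
    define H where "H = (\<lambda>x. ennreal M * ennreal (\<bar>f x\<bar> * (1 + log_plus \<bar>f x\<bar>)))"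
    have Hm [measurable]: "H \<in> borel_measurable lebesgue" unfolding H_def by measurable
    have HI: "(\<integral>\<^sup>+x. H x \<partial>lebesgue) = ennreal M * ?J"
      unfolding H_def by (rule nn_integral_cmult) measurable
    have Hfin: "(\<integral>\<^sup>+x. H x \<partial>lebesgue) < \<infinity>" using fin by (simp add: HI ennreal_mult_less_top)
    define \<Phi> where "\<Phi> x = ennreal (\<bar>f x\<bar> / c' * log_plus (\<bar>f x\<bar> / c'))" for x
    have Pm [measurable]: "\<Phi> \<in> borel_measurable lebesgue" unfolding \<Phi>_def[abs_def] by measurable
    have PH: "4 * \<Phi> x \<le> H x" for x
    proof -
      let ?l = "log_plus \<bar>f x\<bar>" and ?k = "log_plus (1 / c')"
      have "log_plus (\<bar>f x\<bar> / c') \<le> ?l + ?k" using log_plus_mult_le[of "\<bar>f x\<bar>" "1 / c'"] c' by simp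
      also have "\<dots> \<le> (1 + ?k) * (1 + ?l)"
        using log_plus_nonneg[of "\<bar>f x\<bar>"] log_plus_nonneg[of "1 / c'"] by (simp add: algebra_simps)
      finally have "4 * (\<bar>f x\<bar> / c' * log_plus (\<bar>f x\<bar> / c')) \<le> 4 * (\<bar>f x\<bar> / c' * ((1 + ?k) * (1 + ?l)))"
        using c' by (intro mult_left_mono) auto
      also have "\<dots> = M * (\<bar>f x\<bar> * (1 + ?l))" by (simp add: M_def)
      finally have "ennreal (4 * (\<bar>f x\<bar> / c' * log_plus (\<bar>f x\<bar> / c'))) \<le> ennreal (M * (\<bar>f x\<bar> * (1 + ?l)))"
        by (rule ennreal_leI)
      moreover have "ennreal (4 * (\<bar>f x\<bar> / c' * log_plus (\<bar>f x\<bar> / c'))) = 4 * \<Phi> x"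
        unfolding \<Phi>_def using c' log_plus_nonneg by (subst ennreal_mult) auto
      moreover have "ennreal (M * (\<bar>f x\<bar> * (1 + ?l))) = H x"
        unfolding H_def using M0 log_plus_nonneg[of "\<bar>f x\<bar>"] by (subst ennreal_mult) auto
      ultimately show ?thesis by simp
    qed
    define F where "F = {(y, h). h > 0 \<and> emeasure lebesgue (cube y h) \<le> (\<integral>\<^sup>+x\<in>cube y h. H x \<partial>lebesgue)}"
    have HF: "0 < h \<and> emeasure lebesgue (cube y h) \<le> (\<integral>\<^sup>+x\<in>cube y h. H x \<partial>lebesgue)" if "(y, h) \<in> F" for y h
      using that by (simp add: F_def)
    obtain C where C: "countable C" "C \<subseteq> F"
      "\<And>y h. (y, h) \<in> F \<Longrightarrow> \<exists>(y', h') \<in> C. cube y h \<subseteq> dilate y' h'"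
      "(\<integral>\<^sup>+(y, h). emeasure lebesgue (dilate y h) \<partial>count_space C) \<le> ennreal D * (\<integral>\<^sup>+x. H x \<partial>lebesgue)"
      unfolding D_def by (rule weak_type_cubes[of H F]) (use Hm Hfin HF in blast)+
    show "\<exists>T\<in>sets lebesgue. emeasure lebesgue T \<le> ennreal (D * M) * ?J \<and>
      (\<forall>x y h. h > 0 \<and> x \<in> cube y h \<and>
        ennreal (h ^ CARD('n) / 2) < (\<integral>\<^sup>+z\<in>cube y h. ennreal (\<bar>b z - cube_mean b (cube y h)\<bar> * \<bar>f z\<bar>) \<partial>lebesgue)
        \<longrightarrow> x \<in> T)"
    proof (rule bexI[of _ "\<Union>i\<in>C. case i of (y, h) \<Rightarrow> dilate y h"], intro conjI allI impI)
      show "(\<Union>i\<in>C. case i of (y, h) \<Rightarrow> dilate y h) \<in> sets lebesgue" using C(1) by (intro sets.countable_UN') auto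
      have "emeasure lebesgue (\<Union>i\<in>C. case i of (y, h) \<Rightarrow> dilate y h) \<le> (\<integral>\<^sup>+(y, h). emeasure lebesgue (dilate y h) \<partial>count_space C)"
        using emeasure_UN_le_nn_integral[OF C(1), of "\<lambda>(y, h). dilate y h" lebesgue] by (simp add: case_prod_beta')
      also have "\<dots> \<le> ennreal D * (ennreal M * ?J)" using C(4) by (simp add: HI)
      also have "\<dots> = ennreal (D * M) * ?J" using D0 M0 by (simp add: ennreal_mult mult.assoc)
      finally show "emeasure lebesgue (\<Union>i\<in>C. case i of (y, h) \<Rightarrow> dilate y h) \<le> ennreal (D * M) * ?J" .
    next
      fix x y h
      define m where "m = cube_mean b (cube y h)"
      assume x: "h > 0 \<and> x \<in> cube y h \<and>
        ennreal (h ^ CARD('n) / 2) < (\<integral>\<^sup>+z\<in>cube y h. ennreal (\<bar>b z - cube_mean b (cube y h)\<bar> * \<bar>f z\<bar>) \<partial>lebesgue)"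
      let ?P = "\<integral>\<^sup>+z\<in>cube y h. \<Phi> z \<partial>lebesgue"
      have "ennreal (h ^ CARD('n) / 4) + ennreal (h ^ CARD('n) / 4) = ennreal (h ^ CARD('n) / 2)"
        using x by (simp flip: ennreal_plus)
      also have "\<dots> \<le> (\<integral>\<^sup>+z\<in>cube y h. ennreal (\<bar>b z - m\<bar> * \<bar>f z\<bar>) \<partial>lebesgue)" using x by (simp add: m_def less_imp_le)
      also have "\<dots> \<le> (\<integral>\<^sup>+z. \<Phi> z * indicator (cube y h) z + ennreal (exp (c' * \<bar>b z - m\<bar>) - 1) * indicator (cube y h) z \<partial>lebesgue)"
      proof (rule nn_integral_mono)
        fix z
        have "\<bar>b z - m\<bar> * \<bar>f z\<bar> = \<bar>f z\<bar> / c' * (c' * \<bar>b z - m\<bar>)" using c' by simp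
        also have "\<dots> \<le> \<bar>f z\<bar> / c' * log_plus (\<bar>f z\<bar> / c') + (exp (c' * \<bar>b z - m\<bar>) - 1)"
          using c' by (intro young_exp_log) auto
        finally have "ennreal (\<bar>b z - m\<bar> * \<bar>f z\<bar>) \<le> ennreal (\<bar>f z\<bar> / c' * log_plus (\<bar>f z\<bar> / c') + (exp (c' * \<bar>b z - m\<bar>) - 1))"
          by (rule ennreal_leI)
        also have "\<dots> = \<Phi> z + ennreal (exp (c' * \<bar>b z - m\<bar>) - 1)"
          unfolding \<Phi>_def using c' log_plus_nonneg by (intro ennreal_plus) auto
        finally show "ennreal (\<bar>b z - m\<bar> * \<bar>f z\<bar>) * indicator (cube y h) z
          \<le> \<Phi> z * indicator (cube y h) z + ennreal (exp (c' * \<bar>b z - m\<bar>) - 1) * indicator (cube y h) z"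
          by (auto split: split_indicator)
      qed
      also have "\<dots> = ?P + (\<integral>\<^sup>+z\<in>cube y h. ennreal (exp (c' * \<bar>b z - m\<bar>) - 1) \<partial>lebesgue)"
        by (rule nn_integral_add) measurable
      also have "\<dots> \<le> ?P + ennreal (h ^ CARD('n) / 4)"
        using jn'[of h y] x by (intro add_left_mono) (simp add: m_def)
      finally have "ennreal (h ^ CARD('n) / 4) + ennreal (h ^ CARD('n) / 4) \<le> ennreal (h ^ CARD('n) / 4) + ?P"
        by (simp only: add.commute)
      then have "ennreal (h ^ CARD('n) / 4) \<le> ?P" by (subst (asm) ennreal_add_left_cancel_le) simp
      then have "4 * ennreal (h ^ CARD('n) / 4) \<le> 4 * ?P" by (intro mult_left_mono) auto
      also have "4 * ?P = (\<integral>\<^sup>+z. 4 * (\<Phi> z * indicator (cube y h) z) \<partial>lebesgue)"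
        by (rule nn_integral_cmult[symmetric]) measurable
      also have "\<dots> \<le> (\<integral>\<^sup>+z\<in>cube y h. H z \<partial>lebesgue)"
        using PH by (intro nn_integral_mono) (auto split: split_indicator)
      also have "4 * ennreal (h ^ CARD('n) / 4) = emeasure lebesgue (cube y h)"
        using x by (simp add: emeasure_cube flip: ennreal_numeral ennreal_mult)
      finally have "(y, h) \<in> F" using x by (simp add: F_def)
      then obtain i where "i \<in> C" "cube y h \<subseteq> (case i of (y, h) \<Rightarrow> dilate y h)" using C(3) by fastforce
      then show "x \<in> (\<Union>i\<in>C. case i of (y, h) \<Rightarrow> dilate y h)" using x by blast
    qed
  qed
qed

end

subsection \<open>The maximal commutator\<close>

text \<open>A strict inequality below a supremum is witnessed by a single cube, and multiplying by
  its volume removes the quotient in \<open>ennreal\<close>.\<close>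

lemma less_maximal_commutator_iff:
  fixes b f :: "real ^ 'n \<Rightarrow> real"
  assumes "l \<ge> 0"
  shows "ennreal l < maximal_commutator b f x \<longleftrightarrow>
    (\<exists>a s. s > 0 \<and> x \<in> cube a s \<and>
      ennreal (l * s ^ CARD('n)) < (\<integral>\<^sup>+y\<in>cube a s. ennreal (\<bar>b x - b y\<bar> * \<bar>f y\<bar>) \<partial>lebesgue))"
proof -
  have "ennreal l < maximal_commutator b f x \<longleftrightarrow>
    (\<exists>a s. s > 0 \<and> x \<in> cube a s \<and>
      ennreal l < (\<integral>\<^sup>+y\<in>cube a s. ennreal (\<bar>b x - b y\<bar> * \<bar>f y\<bar>) \<partial>lebesgue) / emeasure lebesgue (cube a s))"
    unfolding maximal_commutator_def less_SUP_iff cubes_eq by blast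
  also have "\<dots> \<longleftrightarrow> (\<exists>a s. s > 0 \<and> x \<in> cube a s \<and>
      ennreal (l * s ^ CARD('n)) < (\<integral>\<^sup>+y\<in>cube a s. ennreal (\<bar>b x - b y\<bar> * \<bar>f y\<bar>) \<partial>lebesgue))"
    using assms by (intro arg_cong[where f = Ex] ext conj_cong refl) (simp add: emeasure_cube ennreal_less_divide_iff)
  finally show ?thesis .
qed

text \<open>Serves the measurability in \<open>x\<close> of integrals over \<open>y\<close> whose
  integrand also depends on \<open>x\<close>.\<close>

lemma sigma_finite_lebesgue: "sigma_finite_measure (lebesgue :: 'a::euclidean_space measure)"
proof
  obtain A :: "'a set set" where A: "countable A" "A \<subseteq> sets lborel" "\<Union>A = space lborel" "\<forall>a\<in>A. emeasure lborel a \<noteq> \<infinity>"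
    using lborel.sigma_finite_countable by blast
  then show "\<exists>A::'a set set. countable A \<and> A \<subseteq> sets lebesgue \<and> \<Union>A = space lebesgue \<and> (\<forall>a\<in>A. emeasure lebesgue a \<noteq> \<infinity>)"
    by (intro exI[of _ A]) (auto simp: emeasure_completion)
qed

text \<open>Cubes with rational data suffice: enlarge a cube slightly, keeping the average above the level.\<close>

lemma sets_maximal_commutator_superlevel:
  fixes b f :: "real ^ 'n \<Rightarrow> real"
  assumes [measurable]: "b \<in> borel_measurable lebesgue" "f \<in> borel_measurable lebesgue" and l: "l \<ge> 0"
  shows "{x. ennreal l < maximal_commutator b f x} \<in> sets lebesgue"
proof -
  interpret sigma_finite_measure "lebesgue :: (real ^ 'n) measure" by (rule sigma_finite_lebesgue)
  define G where "G i x = (\<integral>\<^sup>+y\<in>cube (fst i) (snd i). ennreal (\<bar>b x - b y\<bar> * \<bar>f y\<bar>) \<partial>lebesgue)" for i x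
  have Gm [measurable]: "G i \<in> borel_measurable lebesgue" for i
    unfolding G_def[abs_def] by measurable
  define R :: "((real ^ 'n) \<times> real) set" where "R = {a. \<forall>i. a $ i \<in> \<rat>} \<times> {s \<in> \<rat>. s > 0}"
  have "countable {s \<in> \<rat>. s > (0::real)}" using countable_rat by (rule countable_subset[rotated]) auto
  then have Rc: "countable R" unfolding R_def by (intro countable_SIGMA countable_vector countable_rat)
  have "{x. ennreal l < maximal_commutator b f x}
    = (\<Union>i\<in>R. cube (fst i) (snd i) \<inter> {x \<in> space lebesgue. ennreal (l * snd i ^ CARD('n)) < G i x})" (is "?L = ?R")
  proof (intro equalityI subsetI)
    fix x assume "x \<in> ?L"
    then obtain a s where s: "s > 0" and x: "x \<in> cube a s" and lt: "ennreal (l * s ^ CARD('n)) < G (a, s) x"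
      using l by (auto simp: less_maximal_commutator_iff G_def)
    \<comment> \<open>The level term is continuous in the side, so the strict inequality leaves room
      for sides up to some \<open>r > s\<close>. Half of that room, \<open>e\<close>, bounds the
      shift of the corner; a side above \<open>s + e\<close> then still reaches past the original
      cube.\<close>
    have "((\<lambda>t. ennreal (l * t ^ CARD('n))) \<longlongrightarrow> ennreal (l * s ^ CARD('n))) (at_right s)"
      by (intro tendsto_ennrealI tendsto_intros)
    from order_tendstoD(2)[OF this lt] obtain r where r: "r > s" "\<And>t. s < t \<Longrightarrow> t < r \<Longrightarrow> ennreal (l * t ^ CARD('n)) < G (a, s) x"
      by (auto simp: eventually_at_right_field)
    define e where "e = (r - s) / 2"
    have e: "e > 0" "s + e < r" using r(1) by (simp_all add: e_def field_simps)
    have "\<forall>i. \<exists>q\<in>\<rat>. a $ i - e < q \<and> q < a $ i" using e Rats_dense_in_real by simp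
    then obtain q where q: "\<And>i. q i \<in> \<rat>" "\<And>i. a $ i - e < q i" "\<And>i. q i < a $ i" by metis
    obtain t where t: "t \<in> \<rat>" "s + e < t" "t < r" using Rats_dense_in_real[OF e(2)] by blast
    let ?a = "\<chi> i. q i"
    have sub: "cube a s \<subseteq> cube ?a t"
    proof (rule cube_subset_cubeI)
      show "?a $ i \<le> a $ i" for i using q(3)[of i] by simp
      show "a $ i + s \<le> ?a $ i + t" for i using q(2)[of i] t(2) by simp
    qed
    have "ennreal (l * t ^ CARD('n)) < G (a, s) x" using t e by (intro r) auto
    also have "\<dots> \<le> G (?a, t) x"
      unfolding G_def using sub by (intro nn_integral_mono) (auto split: split_indicator)
    finally have "x \<in> cube ?a t \<inter> {x \<in> space lebesgue. ennreal (l * t ^ CARD('n)) < G (?a, t) x}"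
      using sub x by auto
    moreover have "(?a, t) \<in> R" using q(1) t s e by (simp add: R_def)
    ultimately show "x \<in> ?R" by force
  next
    fix x assume "x \<in> ?R"
    then show "x \<in> ?L" using l by (auto simp: less_maximal_commutator_iff G_def R_def)
  qed
  also have "\<dots> \<in> sets lebesgue"
    using Rc by (intro sets.countable_UN' sets.Int sets_cube) auto
  finally show ?thesis .
qed

section \<open>Necessity of BMO\<close>

lemma weak_type_imp_BMO:
  fixes b :: "real ^ 'n \<Rightarrow> real"
  assumes loc: "locally_integrable b" and C: "C > 0"
    and weak: "\<And>lam f. lam > 0 \<Longrightarrow> f \<in> L_log_L \<Longrightarrow>
            emeasure lebesgue {x. maximal_commutator b f x > ennreal lam}
              \<le> ennreal C * (\<integral>\<^sup>+x. ennreal (\<bar>f x\<bar> / lam * (1 + log_plus (\<bar>f x\<bar> / lam))) \<partial>lebesgue)"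
  shows "b \<in> BMO"
proof -
  \<comment> \<open>\<open>l \<ge> 1\<close> makes the logarithmic term vanish for the indicator
    divided by \<open>l\<close>, and \<open>C < l\<close> makes the superlevel set smaller than the
    cube.\<close>
  define l where "l = C + 1"
  have l: "l > 0" "l \<ge> 1" "C < l" using C by (auto simp: l_def)
  note [measurable] = locally_integrable_measurable[OF loc]
  have "(\<integral>\<^sup>+y\<in>Q. ennreal \<bar>b y - cube_mean b Q\<bar> \<partial>lebesgue) / emeasure lebesgue Q \<le> ennreal (2 * l)" if "Q \<in> cubes" for Q
  proof -
    obtain a s where s: "s > 0" and Q: "Q = cube a s" using \<open>Q \<in> cubes\<close> by (auto simp: cubes_eq)
    define v where "v = s ^ CARD('n)"
    have v: "v > 0" "emeasure lebesgue Q = ennreal v" using s by (simp_all add: v_def Q emeasure_cube)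
    define f :: "real ^ 'n \<Rightarrow> real" where "f = indicator Q"
    have fm: "f \<in> borel_measurable lebesgue" by (simp add: f_def Q)
    have L: "(\<integral>\<^sup>+x. ennreal (\<bar>f x\<bar> / t * (1 + log_plus (\<bar>f x\<bar> / t))) \<partial>lebesgue) = ennreal (1 / t) * ennreal v" if "t \<ge> 1" for t
    proof -
      have "ln (1 / t) \<le> 0" using that by (simp add: ln_div)
      then have "log_plus (1 / t) = 0" by (simp add: log_plus_def)
      then have "(\<integral>\<^sup>+x. ennreal (\<bar>f x\<bar> / t * (1 + log_plus (\<bar>f x\<bar> / t))) \<partial>lebesgue)
          = (\<integral>\<^sup>+x. ennreal (1 / t) * indicator Q x \<partial>lebesgue)"
        by (intro nn_integral_cong) (auto simp: f_def split: split_indicator)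
      then show ?thesis by (simp add: nn_integral_cmult v(2)) (simp add: Q nn_integral_cmult v(2)[unfolded Q])
    qed
    have fL: "f \<in> L_log_L" using fm L[of 1] by (simp add: L_log_L_def)
    let ?S = "{x. maximal_commutator b f x > ennreal l}"
    \<comment> \<open>Essential at this point: \<open>emeasure\<close> takes the default value 0 on
      a nonmeasurable set, so without this a small value would not stop the set from containing the
      cube.\<close>
    have Sm: "?S \<in> sets lebesgue" using fm l by (intro sets_maximal_commutator_superlevel) auto
    have "emeasure lebesgue ?S \<le> ennreal C * (ennreal (1 / l) * ennreal v)" using weak[OF l(1) fL] L[OF l(2)] by simp
    also have "\<dots> = ennreal (C / l * v)" using C l v by (simp flip: ennreal_mult)
    also have "\<dots> < ennreal (1 * v)" using C l v by (intro ennreal_lessI mult_strict_right_mono) auto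
    also have "\<dots> = emeasure lebesgue Q" using v by simp
    finally have "\<not> Q \<subseteq> ?S" using emeasure_mono[OF _ Sm, of Q] by (auto simp: not_le)
    then obtain x where x: "x \<in> Q" "\<not> ennreal l < maximal_commutator b f x" by blast
    have "(\<integral>\<^sup>+y\<in>Q. ennreal \<bar>b y - b x\<bar> \<partial>lebesgue) = (\<integral>\<^sup>+y\<in>Q. ennreal (\<bar>b x - b y\<bar> * \<bar>f y\<bar>) \<partial>lebesgue)"
      by (intro nn_integral_cong) (auto simp: f_def abs_minus_commute split: split_indicator)
    also have "\<dots> \<le> ennreal (l * v)"
      using x s l unfolding less_maximal_commutator_iff[OF less_imp_le[OF l(1)]] Q v_def by (meson not_le)
    finally have osc: "(\<integral>\<^sup>+y\<in>Q. ennreal \<bar>b y - b x\<bar> \<partial>lebesgue) \<le> ennreal (l * v)" .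
    have "ennreal (\<bar>cube_mean b Q - b x\<bar> * v) \<le> ennreal (l * v)"
      using mean_diff_le[OF loc s, of a "b x"] osc unfolding Q v_def by (rule order_trans)
    then have md: "\<bar>cube_mean b Q - b x\<bar> \<le> l" using v l by simp
    have "(\<integral>\<^sup>+y\<in>Q. ennreal \<bar>b y - cube_mean b Q\<bar> \<partial>lebesgue)
       \<le> (\<integral>\<^sup>+y. ennreal \<bar>b y - b x\<bar> * indicator Q y + ennreal l * indicator Q y \<partial>lebesgue)"
    proof (rule nn_integral_mono)
      fix y
      have "ennreal \<bar>b y - cube_mean b Q\<bar> \<le> ennreal (\<bar>b y - b x\<bar> + l)" using md by (intro ennreal_leI) linarith
      also have "\<dots> = ennreal \<bar>b y - b x\<bar> + ennreal l" using l by (intro ennreal_plus) auto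
      finally show "ennreal \<bar>b y - cube_mean b Q\<bar> * indicator Q y \<le> ennreal \<bar>b y - b x\<bar> * indicator Q y + ennreal l * indicator Q y"
        by (auto split: split_indicator)
    qed
    also have "\<dots> = (\<integral>\<^sup>+y\<in>Q. ennreal \<bar>b y - b x\<bar> \<partial>lebesgue) + ennreal l * emeasure lebesgue Q"
      unfolding Q by (simp add: nn_integral_add nn_integral_cmult)
    also have "\<dots> \<le> ennreal (l * v) + ennreal l * ennreal v" using osc v by (simp add: add_right_mono)
    also have "\<dots> = ennreal (2 * l * v)" using l v by (simp flip: ennreal_mult ennreal_plus)
    finally have "\<not> ennreal (2 * l * v) < (\<integral>\<^sup>+y\<in>Q. ennreal \<bar>b y - cube_mean b Q\<bar> \<partial>lebesgue)" by (simp add: not_less)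
    then show ?thesis
      using ennreal_less_divide_iff[of v "2 * l"] v l by (simp add: not_less[symmetric])
  qed
  then have "bmo_norm b \<le> ennreal (2 * l)" unfolding bmo_norm_def by (rule SUP_least)
  then show ?thesis using loc by (auto simp: BMO_def intro: order_le_less_trans)
qed

section \<open>Sufficiency of BMO\<close>

lemma BMO_imp_weak_type:
  fixes b :: "real ^ 'n \<Rightarrow> real"
  assumes "b \<in> BMO"
  obtains C where "C > 0" "\<And>lam f. lam > 0 \<Longrightarrow> f \<in> borel_measurable lebesgue \<Longrightarrow>
     emeasure lebesgue {x. maximal_commutator b f x > ennreal lam}
       \<le> ennreal C * (\<integral>\<^sup>+x. ennreal (\<bar>f x\<bar> / lam * (1 + log_plus (\<bar>f x\<bar> / lam))) \<partial>lebesgue)"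
proof -
  obtain B where "bmo b B" using assms by (rule BMO_imp_bmo)
  then interpret bmo b B .
  obtain C1 where C1: "C1 > 0" "\<And>f. f \<in> borel_measurable lebesgue \<Longrightarrow> (\<integral>\<^sup>+x. ennreal \<bar>f x\<bar> \<partial>lebesgue) < \<infinity> \<Longrightarrow>
    \<exists>T\<in>sets lebesgue. emeasure lebesgue T \<le> ennreal C1 * (\<integral>\<^sup>+x. ennreal \<bar>f x\<bar> \<partial>lebesgue) \<and>
      (\<forall>x y h. h > 0 \<and> x \<in> cube y h \<and>
        ennreal (h ^ CARD('n) / 2) < ennreal \<bar>b x - cube_mean b (cube y h)\<bar> * (\<integral>\<^sup>+z\<in>cube y h. ennreal \<bar>f z\<bar> \<partial>lebesgue)
        \<longrightarrow> x \<in> T)"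
    by (rule weak_type_oscillation) blast
  obtain C2 where C2: "C2 > 0" "\<And>f. f \<in> borel_measurable lebesgue \<Longrightarrow>
    (\<integral>\<^sup>+x. ennreal (\<bar>f x\<bar> * (1 + log_plus \<bar>f x\<bar>)) \<partial>lebesgue) < \<infinity> \<Longrightarrow>
    \<exists>T\<in>sets lebesgue. emeasure lebesgue T \<le> ennreal C2 * (\<integral>\<^sup>+x. ennreal (\<bar>f x\<bar> * (1 + log_plus \<bar>f x\<bar>)) \<partial>lebesgue) \<and>
      (\<forall>x y h. h > 0 \<and> x \<in> cube y h \<and>
        ennreal (h ^ CARD('n) / 2) < (\<integral>\<^sup>+z\<in>cube y h. ennreal (\<bar>b z - cube_mean b (cube y h)\<bar> * \<bar>f z\<bar>) \<partial>lebesgue)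
        \<longrightarrow> x \<in> T)"
    by (rule weak_type_LlogL) blast
  show thesis
  proof (rule that)
    show "C1 + C2 > 0" using C1(1) C2(1) by simp
    fix lam :: real and f :: "real ^ 'n \<Rightarrow> real"
    assume lam: "lam > 0" and fm [measurable]: "f \<in> borel_measurable lebesgue"
    \<comment> \<open>Dividing by \<open>lam\<close> reduces everything to level 1, which is then
      shared equally between the two terms; hence the \<open>h ^ CARD('n) / 2\<close> in both weak
      type bounds.\<close>
    define g where "g = (\<lambda>x. f x / lam)"
    have gm [measurable]: "g \<in> borel_measurable lebesgue" by (simp add: g_def)
    let ?J = "\<integral>\<^sup>+x. ennreal (\<bar>g x\<bar> * (1 + log_plus \<bar>g x\<bar>)) \<partial>lebesgue"
    have J: "(\<integral>\<^sup>+x. ennreal (\<bar>f x\<bar> / lam * (1 + log_plus (\<bar>f x\<bar> / lam))) \<partial>lebesgue) = ?J"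
      using lam by (simp add: g_def)
    have IJ: "(\<integral>\<^sup>+x. ennreal \<bar>g x\<bar> \<partial>lebesgue) \<le> ?J"
      using log_plus_nonneg by (intro nn_integral_mono ennreal_leI) (simp add: mult_le_cancel_left1)
    show "emeasure lebesgue {x. maximal_commutator b f x > ennreal lam} \<le> ennreal (C1 + C2) *
       (\<integral>\<^sup>+x. ennreal (\<bar>f x\<bar> / lam * (1 + log_plus (\<bar>f x\<bar> / lam))) \<partial>lebesgue)"
    \<comment> \<open>An infinite right side makes the bound trivial, the constant being positive.
      The case split replaces a proof that scaling by \<open>lam\<close> preserves membership in
      \<open>L_log_L\<close>.\<close>
    proof (cases "?J < \<infinity>")
      case False
      then have "?J = \<infinity>" by (simp add: not_less top_unique)
      then show ?thesis unfolding J using C1(1) C2(1) by (simp add: ennreal_mult_top)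
    next
      case True
      then have fin1: "(\<integral>\<^sup>+x. ennreal \<bar>g x\<bar> \<partial>lebesgue) < \<infinity>" using IJ by (rule order_le_less_trans[rotated])
      obtain T1 where T1: "T1 \<in> sets lebesgue" "emeasure lebesgue T1 \<le> ennreal C1 * (\<integral>\<^sup>+x. ennreal \<bar>g x\<bar> \<partial>lebesgue)"
        "\<And>x y h. h > 0 \<Longrightarrow> x \<in> cube y h \<Longrightarrow>
          ennreal (h ^ CARD('n) / 2) < ennreal \<bar>b x - cube_mean b (cube y h)\<bar> * (\<integral>\<^sup>+z\<in>cube y h. ennreal \<bar>g z\<bar> \<partial>lebesgue) \<Longrightarrow> x \<in> T1"
        using C1(2)[OF gm fin1] by blast
      obtain T2 where T2: "T2 \<in> sets lebesgue" "emeasure lebesgue T2 \<le> ennreal C2 * ?J"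
        "\<And>x y h. h > 0 \<Longrightarrow> x \<in> cube y h \<Longrightarrow>
          ennreal (h ^ CARD('n) / 2) < (\<integral>\<^sup>+z\<in>cube y h. ennreal (\<bar>b z - cube_mean b (cube y h)\<bar> * \<bar>g z\<bar>) \<partial>lebesgue) \<Longrightarrow> x \<in> T2"
        using C2(2)[OF gm True] by blast
      have "{x. maximal_commutator b f x > ennreal lam} \<subseteq> T1 \<union> T2"
      proof
        fix x assume "x \<in> {x. maximal_commutator b f x > ennreal lam}"
        then obtain a s where s: "s > 0" and x: "x \<in> cube a s"
          and lt: "ennreal (lam * s ^ CARD('n)) < (\<integral>\<^sup>+y\<in>cube a s. ennreal (\<bar>b x - b y\<bar> * \<bar>f y\<bar>) \<partial>lebesgue)"
          using lam by (auto simp: less_maximal_commutator_iff)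
        define m where "m = cube_mean b (cube a s)"
        define v where "v = s ^ CARD('n)"
        have v: "v > 0" using s by (simp add: v_def)
        let ?G = "\<integral>\<^sup>+y\<in>cube a s. ennreal \<bar>g y\<bar> \<partial>lebesgue"
        let ?H = "\<integral>\<^sup>+y\<in>cube a s. ennreal (\<bar>b y - m\<bar> * \<bar>g y\<bar>) \<partial>lebesgue"
        have "ennreal lam * ennreal v < (\<integral>\<^sup>+y\<in>cube a s. ennreal (\<bar>b x - b y\<bar> * \<bar>f y\<bar>) \<partial>lebesgue)"
          using lt lam v by (simp add: v_def ennreal_mult)
        also have "\<dots> = (\<integral>\<^sup>+y. ennreal lam * (ennreal (\<bar>b x - b y\<bar> * \<bar>g y\<bar>) * indicator (cube a s) y) \<partial>lebesgue)"
          using lam by (intro nn_integral_cong) (auto simp: g_def split: split_indicator simp flip: ennreal_mult)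
        also have "\<dots> = ennreal lam * (\<integral>\<^sup>+y\<in>cube a s. ennreal (\<bar>b x - b y\<bar> * \<bar>g y\<bar>) \<partial>lebesgue)"
          by (rule nn_integral_cmult) measurable
        finally have "ennreal v < (\<integral>\<^sup>+y\<in>cube a s. ennreal (\<bar>b x - b y\<bar> * \<bar>g y\<bar>) \<partial>lebesgue)"
          by (meson mult_left_mono not_le zero_le)
        also have "\<dots> \<le> (\<integral>\<^sup>+y. ennreal \<bar>b x - m\<bar> * (ennreal \<bar>g y\<bar> * indicator (cube a s) y)
             + ennreal (\<bar>b y - m\<bar> * \<bar>g y\<bar>) * indicator (cube a s) y \<partial>lebesgue)"
        proof (rule nn_integral_mono)
          fix y
          have "\<bar>b x - b y\<bar> * \<bar>g y\<bar> \<le> (\<bar>b x - m\<bar> + \<bar>b y - m\<bar>) * \<bar>g y\<bar>" by (intro mult_right_mono) auto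
          then have "ennreal (\<bar>b x - b y\<bar> * \<bar>g y\<bar>) \<le> ennreal (\<bar>b x - m\<bar> * \<bar>g y\<bar> + \<bar>b y - m\<bar> * \<bar>g y\<bar>)"
            by (intro ennreal_leI) (simp add: distrib_right)
          also have "\<dots> = ennreal \<bar>b x - m\<bar> * ennreal \<bar>g y\<bar> + ennreal (\<bar>b y - m\<bar> * \<bar>g y\<bar>)"
            by (simp add: ennreal_mult ennreal_plus)
          finally show "ennreal (\<bar>b x - b y\<bar> * \<bar>g y\<bar>) * indicator (cube a s) y
            \<le> ennreal \<bar>b x - m\<bar> * (ennreal \<bar>g y\<bar> * indicator (cube a s) y) + ennreal (\<bar>b y - m\<bar> * \<bar>g y\<bar>) * indicator (cube a s) y"
            by (auto split: split_indicator)
        qed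
        also have "\<dots> = ennreal \<bar>b x - m\<bar> * ?G + ?H"
          by (subst nn_integral_add) (auto simp: nn_integral_cmult)
        finally have sum: "ennreal (v / 2) + ennreal (v / 2) < ennreal \<bar>b x - m\<bar> * ?G + ?H"
          using v by (simp flip: ennreal_plus)
        then have "ennreal (v / 2) < ennreal \<bar>b x - m\<bar> * ?G \<or> ennreal (v / 2) < ?H"
          by (meson add_mono not_le)
        then show "x \<in> T1 \<union> T2" using T1(3)[OF s x] T2(3)[OF s x] unfolding m_def v_def by blast
      qed
      then have "emeasure lebesgue {x. maximal_commutator b f x > ennreal lam} \<le> emeasure lebesgue (T1 \<union> T2)"
        using T1(1) T2(1) by (intro emeasure_mono) auto
      also have "\<dots> \<le> emeasure lebesgue T1 + emeasure lebesgue T2" using T1(1) T2(1) by (rule emeasure_subadditive)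
      also have "\<dots> \<le> ennreal C1 * ?J + ennreal C2 * ?J"
        using T1(2) T2(2) IJ by (meson add_mono mult_left_mono order_trans zero_le)
      also have "\<dots> = ennreal (C1 + C2) * ?J" using C1(1) C2(1) by (simp add: distrib_right ennreal_plus)
      finally show ?thesis unfolding J .
    qed
  qed
qed

theorem theorem4p1:
  fixes b :: "real ^ 'n \<Rightarrow> real"
  assumes "locally_integrable b"
  shows "(\<exists>C::real. C > 0 \<and> (\<forall>lam::real. lam > 0 \<longrightarrow> (\<forall>f\<in>L_log_L.
            emeasure lebesgue {x. maximal_commutator b f x > ennreal lam}
              \<le> ennreal C * (\<integral>\<^sup>+x. ennreal (\<bar>f x\<bar> / lam * (1 + log_plus (\<bar>f x\<bar> / lam))) \<partial>lebesgue))))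
         \<longleftrightarrow> b \<in> BMO" (is "?weak \<longleftrightarrow> _")
proof
  assume ?weak
  then show "b \<in> BMO" using weak_type_imp_BMO[OF assms] by blast
next
  assume "b \<in> BMO"
  then obtain C where "C > 0" and C: "\<And>lam f. lam > 0 \<Longrightarrow> f \<in> borel_measurable lebesgue \<Longrightarrow>
     emeasure lebesgue {x. maximal_commutator b f x > ennreal lam}
       \<le> ennreal C * (\<integral>\<^sup>+x. ennreal (\<bar>f x\<bar> / lam * (1 + log_plus (\<bar>f x\<bar> / lam))) \<partial>lebesgue)"
    by (rule BMO_imp_weak_type) blast
  then show ?weak by (intro exI[of _ C]) (auto simp: L_log_L_def)
qed

end
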